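(* Let $X$ and $Y$ be path-connected ANR spaces. (1) $\mathsf{icat}(X)\le\mathsf{dcat}(X)\le\mathsf{cat}(X)$. (2) If $f:X\to Y$ is a homotopy domination, then $\mathsf{icat}(Y)\le\mathsf{icat}(X)$. (3) $\mathsf{icat}$ is a homotopy invariant of spaces: if $X\simeq Y$ then $\mathsf{icat}(X)=\mathsf{icat}(Y)$. (4) $\max\{\mathsf{icat}(X),\mathsf{icat}(Y)\}\le\min\{\mathsf{icat}(X\vee Y),\mathsf{icat}(X\times Y)\}$.
   Context: $I=[0,1]$. A continuous map $f:X\to Y$ is a homotopy domination if there is a continuous $g:Y\to X$ with $fg\simeq \mathrm{id}_Y$. $X\vee Y$ is the wedge with respect to chosen basepoints. For a metric space $Z$ and $n\ge 1$, $\mathcal B_n(Z)$ is the space of probability measures on $Z$ whose support has at most $n$ points, written as finite formal convex combinations $\sum\lambda_z z$ with $\lambda_z>0$, $\sum\lambda_z=1$, equipped with the Lévy–Prokhorov metric; $\delta_z$ is the Dirac measure at $z$. $P(Z)$ is the space of continuous paths $I\to Z$ with the compact-open topology. Define $\Phi_n:\mathcal B_n(P(X))\to P(\mathcal B_n(X))$ by $\Phi_n(\sum\lambda_\alpha\alpha)(t)=\sum\lambda_\alpha\alpha(t)$. A path $f\in P(\mathcal B_n(X))$ is resolvable if $f=\Phi_n(\mu)$ for some $\mu\in\mathcal B_n(P(X))$; $RP(\mathcal B_n(X))\subset P(\mathcal B_n(X))$ is the subspace of resolvable paths. Fix a basepoint $x_0\in X$ and let $RP_0(\mathcal B_k(X))=\{f\in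 RP(\mathcal B_k(X)) : f(1)=\delta_{x_0}\}$. All the following minimal integers are nonnegative (infinite if none exists). $\mathsf{icat}(X)$ is the minimal $n$ such that there is a continuous $H:X\to RP_0(\mathcal B_{n+1}(X))$ with $H(x)(0)=\delta_x$ for all $x\in X$. $\mathsf{dcat}(X)$ is the minimal $n$ such that there is a continuous $H:X\to\mathcal B_{n+1}(P_0(X))$ with $H(x)\in\mathcal B_{n+1}(P(x,x_0))$ for all $x\in X$, where $P_0(X)=\{\gamma\in P(X):\gamma(1)=x_0\}$ and $P(x,x_0)=\{\gamma\in P(X):\gamma(0)=x,\gamma(1)=x_0\}$. $\mathsf{cat}(X)$ is the minimal $n$ such that $X$ is covered by $n+1$ open sets each contractible in $X$. *)

theory Defs
  imports "HOL-Probability.Probability" "HOL-Library.Extended_Nat"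
begin

text \<open>Points of function spaces are extensional functions, as for the library's
  \<^const>\<open>cfunspace\<close>. The case \<^term>\<open>K = {}\<close> puts the set of all continuous maps into
  the subbasis.\<close>

definition compact_open_topology :: "'a topology \<Rightarrow> 'b topology \<Rightarrow> ('a \<Rightarrow> 'b) topology" where
  "compact_open_topology X Y = topology_generated_by
     {{f. continuous_map X Y f \<and> f \<in> extensional (topspace X) \<and> f ` K \<subseteq> U} | K U.
        compactin X K \<and> openin Y U}"

abbreviation unit_interval :: "real topology" where
  "unit_interval \<equiv> top_of_set {0..1}"

definition path_topology :: "'a topology \<Rightarrow> (real \<Rightarrow> 'a) topology" where
  "path_topology Z = compact_open_topology unit_interval Z"

text \<open>The Levy-Prokhorov construction below has to be applied to the space of paths as well, so this
  space needs a metric. The uniform metric is used; it induces the compact-open topology,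
  see \<open>mtopology_of_path_metric\<close>.\<close>

definition path_metric :: "'a metric \<Rightarrow> (real \<Rightarrow> 'a) metric" where
  "path_metric Z = cfunspace unit_interval Z"

lemma topspace_compact_open_topology:
  "topspace (compact_open_topology X Y) = {f. continuous_map X Y f \<and> f \<in> extensional (topspace X)}"
proof -
  have "{f. continuous_map X Y f \<and> f \<in> extensional (topspace X)} =
        {f. continuous_map X Y f \<and> f \<in> extensional (topspace X) \<and> f ` {} \<subseteq> {}}"
    by auto
  moreover have "compactin X {}" "openin Y {}"
    by auto
  ultimately show ?thesis
    unfolding compact_open_topology_def topology_generated_by_topspace by blast
qed

lemma mtopology_of_cfunspace_compact:
  assumes "compact_space X"
  shows "mtopology_of (cfunspace X m) = compact_open_topology X (mtopology_of m)"
proof -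
  note mspace_cfunspace [simp del]
  let ?C = "mspace (cfunspace X m)"
  have Xc: "compactin X (topspace X)"
    using assms compact_space_def by blast
  have C: "?C = {f. continuous_map X (mtopology_of m) f \<and> f \<in> extensional (topspace X)}"
    unfolding compactin_mspace_cfunspace[OF Xc]
    by (auto simp: continuous_map_def Pi_iff)
  interpret F: Metric_space ?C "mdist (cfunspace X m)"
    by (rule Metric_space_mspace_mdist)
  interpret m: Metric_space "mspace m" "mdist m"
    by simp
  define \<B> where "\<B> = {{f. continuous_map X (mtopology_of m) f \<and> f \<in> extensional (topspace X) \<and>
      f ` K \<subseteq> U} | K U. compactin X K \<and> openin (mtopology_of m) U}"
  have mC: "f x \<in> mspace m" if "f \<in> ?C" "x \<in> topspace X" for f x
    using that by (auto simp: mspace_cfunspace)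
  have sub: "openin F.mtopology B" if "B \<in> \<B>" for B
  proof -
    obtain K U where K: "compactin X K" and U: "openin (mtopology_of m) U"
      and B: "B = {f \<in> ?C. f ` K \<subseteq> U}"
      using \<open>B \<in> \<B>\<close> unfolding \<B>_def C by blast
    have KX: "K \<subseteq> topspace X"
      using K compactin_subset_topspace by blast
    have "\<exists>r>0. F.mball f r \<subseteq> B" if f: "f \<in> B" for f
    proof -
      have fC: "f \<in> ?C" and fK: "f ` K \<subseteq> U"
        using f B by auto
      have cf: "continuous_map X (mtopology_of m) f"
        using fC C by blast
      have "\<forall>y\<in>U. \<exists>r>0. m.mball y r \<subseteq> U"
        using U m.openin_mtopology mtopology_of_def by metis
      then obtain r where r: "\<And>y. y \<in> U \<Longrightarrow> 0 < r y \<and> m.mball y (r y) \<subseteq> U"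
        by metis
      have comp: "compactin m.mtopology (f ` K)"
        using image_compactin[OF K cf] by (simp add: mtopology_of_def)
      have fKm: "f ` K \<subseteq> mspace m"
        using KX fC mC by blast
      let ?\<U> = "(\<lambda>y. m.mball y (r y / 2)) ` (f ` K)"
      have "\<exists>\<F>. finite \<F> \<and> \<F> \<subseteq> ?\<U> \<and> f ` K \<subseteq> \<Union>\<F>"
      proof (rule compactinD[OF comp])
        show "openin m.mtopology V" if "V \<in> ?\<U>" for V
          using that by auto
        show "f ` K \<subseteq> \<Union>?\<U>"
        proof
          fix y assume y: "y \<in> f ` K"
          then have "y \<in> m.mball y (r y / 2)"
            using r fK fKm by (simp add: subset_iff)
          then show "y \<in> \<Union>?\<U>"
            using y by blast
        qed
      qed
      then obtain \<F> where \<F>: "finite \<F>" "\<F> \<subseteq> ?\<U>" "f ` K \<subseteq> \<Union>\<F>"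
        by blast
      obtain F where F: "finite F" "F \<subseteq> f ` K" "f ` K \<subseteq> (\<Union>y\<in>F. m.mball y (r y / 2))"
        using finite_subset_image[OF \<F>(1,2)] \<F>(3) by blast
      define s where "s = Min (insert 1 ((\<lambda>y. r y / 2) ` F))"
      have "0 < r y" if "y \<in> F" for y
        using that F(2) fK r by blast
      then have s0: "0 < s"
        unfolding s_def using F(1) by (subst Min_gr_iff) auto
      have s: "s \<le> r y / 2" if "y \<in> F" for y
        unfolding s_def using F(1) that by (intro Min_le) auto
      have "F.mball f s \<subseteq> B"
      proof
        fix g assume g: "g \<in> F.mball f s"
        then have gC: "g \<in> ?C" and d: "mdist (cfunspace X m) f g < s"
          by auto
        have "g x \<in> U" if x: "x \<in> K" for x
        proof -
          have dx: "mdist m (f x) (g x) < s"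
            using cfunspace_mdist_lt[OF Xc fC gC d] x KX by blast
          obtain y where y: "y \<in> F" "f x \<in> m.mball y (r y / 2)"
            using F x by blast
          have ms: "f x \<in> mspace m" "g x \<in> mspace m" "y \<in> mspace m"
            using x KX mC[OF fC] mC[OF gC] y by auto
          have "mdist m y (g x) \<le> mdist m y (f x) + mdist m (f x) (g x)"
            using ms m.triangle by blast
          also have "\<dots> < r y"
            using y s[OF y(1)] dx by simp
          finally have "g x \<in> m.mball y (r y)"
            using ms by simp
          then show ?thesis
            using r y F fK by blast
        qed
        then show "g \<in> B"
          using gC B by blast
      qed
      then show ?thesis
        using s0 by blast
    qed
    then show ?thesis
      using B F.openin_mtopology by blast
  qed
  have sup: "generate_topology_on \<B> W" if W: "openin F.mtopology W" for W
  proof -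
    have loc: "\<exists>V. generate_topology_on \<B> V \<and> f \<in> V \<and> V \<subseteq> W" if f: "f \<in> W" for f
    proof -
      have fC: "f \<in> ?C"
        using f W F.openin_mtopology by blast
      have cf: "continuous_map X m.mtopology f"
        using fC C by (simp add: mtopology_of_def)
      obtain e where e: "e > 0" "F.mball f e \<subseteq> W"
        using W f F.openin_mtopology by blast
      define V where "V x = {y \<in> topspace X. f y \<in> m.mball (f x) (e/4)}" for x
      define K where "K x = {y \<in> topspace X. f y \<in> m.mcball (f x) (e/4)}" for x
      have V: "openin X (V x)" for x
        unfolding V_def using cf m.openin_mball openin_continuous_map_preimage by blast
      have "closedin X (K x)" for x
        unfolding K_def using cf m.closedin_mcball closedin_continuous_map_preimage by blast
      then have K: "compactin X (K x)" for x
        using assms closedin_compact_space by blast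
      have "topspace X \<subseteq> \<Union>(V ` topspace X)"
        using e mC[OF fC] by (fastforce simp: V_def)
      then have "\<exists>\<F>. finite \<F> \<and> \<F> \<subseteq> V ` topspace X \<and> topspace X \<subseteq> \<Union>\<F>"
        using V by (intro compactinD[OF Xc]) auto
      then obtain \<F> where \<F>: "finite \<F>" "\<F> \<subseteq> V ` topspace X" "topspace X \<subseteq> \<Union>\<F>"
        by blast
      obtain G where G: "finite G" "G \<subseteq> topspace X" "topspace X \<subseteq> (\<Union>x\<in>G. V x)"
        using finite_subset_image[OF \<F>(1,2)] \<F>(3) by blast
      define N where "N x = {g. continuous_map X (mtopology_of m) g \<and> g \<in> extensional (topspace X) \<and>
          g ` K x \<subseteq> m.mball (f x) (e/3)}" for x
      have NB: "N x \<in> \<B>" for x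
        unfolding \<B>_def N_def using K[of x] m.openin_mball[of "f x" "e/3"]
        by (auto simp: mtopology_of_def)
      define N0 where "N0 = {g. continuous_map X (mtopology_of m) g \<and> g \<in> extensional (topspace X) \<and>
          g ` {} \<subseteq> {}}"
      have "compactin X {}" "openin (mtopology_of m) {}"
        by auto
      then have N0B: "N0 \<in> \<B>"
        unfolding \<B>_def N0_def by blast
      have N0C: "N0 = ?C"
        unfolding N0_def C by auto
      have gen: "generate_topology_on \<B> (N0 \<inter> (\<Inter>x\<in>H. N x))" if "finite H" for H
        using that
      proof (induction H rule: finite_induct)
        case empty
        then show ?case
          using N0B by (simp add: generate_topology_on.Basis)
      next
        case (insert x H)
        have "generate_topology_on \<B> ((N0 \<inter> (\<Inter>x\<in>H. N x)) \<inter> N x)"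
          using generate_topology_on.Int[OF insert.IH generate_topology_on.Basis[OF NB]] .
        then show ?case
          by (simp add: Int_ac)
      qed
      have "f \<in> N x" if "x \<in> G" for x
      proof -
        have "f ` K x \<subseteq> m.mball (f x) (e/3)"
          using e by (auto simp: K_def)
        then show ?thesis
          using fC unfolding N_def C by blast
      qed
      then have f_in: "f \<in> N0 \<inter> (\<Inter>x\<in>G. N x)"
        using fC N0C by blast
      have "N0 \<inter> (\<Inter>x\<in>G. N x) \<subseteq> F.mball f e"
      proof
        fix g assume g: "g \<in> N0 \<inter> (\<Inter>x\<in>G. N x)"
        then have gC: "g \<in> ?C"
          using N0C by blast
        have "mdist m (f y) (g y) \<le> 7 * e / 12" if y: "y \<in> topspace X" for y
        proof -
          obtain x where x: "x \<in> G" "y \<in> V x"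
            using G y by blast
          then have "y \<in> K x"
            by (auto simp: V_def K_def)
          then have "g y \<in> m.mball (f x) (e/3)"
            using g x unfolding N_def by blast
          moreover have "f y \<in> m.mball (f x) (e/4)"
            using x by (simp add: V_def)
          ultimately show ?thesis
            using m.triangle[of "f y" "f x" "g y"] by (auto simp: m.commute)
        qed
        then have "mdist (cfunspace X m) f g \<le> 7 * e / 12"
          using e by (intro mdist_cfunspace_le) auto
        also have "\<dots> < e"
          using e by simp
        finally show "g \<in> F.mball f e"
          using fC gC by (simp only: F.in_mball)
      qed
      then show ?thesis
        using e gen[OF G(1)] f_in by blast
    qed
    then have "W = \<Union>{V. generate_topology_on \<B> V \<and> V \<subseteq> W}"
      by blast
    then show ?thesis
      by (metis (no_types, lifting) generate_topology_on.UN mem_Collect_eq)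
  qed
  have "openin (compact_open_topology X (mtopology_of m)) W \<longleftrightarrow> generate_topology_on \<B> W" for W
    unfolding compact_open_topology_def \<B>_def[symmetric] by (rule openin_topology_generated_by_iff)
  moreover have "openin F.mtopology W" if "generate_topology_on \<B> W" for W
    using that by induction (use sub in auto)
  ultimately show ?thesis
    unfolding topology_eq mtopology_of_def using sup by blast
qed

lemma mtopology_of_path_metric:
  "mtopology_of (path_metric Z) = path_topology (mtopology_of Z)"
  unfolding path_metric_def path_topology_def
  by (intro mtopology_of_cfunspace_compact) (simp add: compact_space_subtopology)

definition borel_sets_of :: "'a metric \<Rightarrow> 'a set set" where
  "borel_sets_of Z = sigma_sets (mspace Z) {U. openin (mtopology_of Z) U}"

definition nbhd_of :: "'a metric \<Rightarrow> 'a set \<Rightarrow> real \<Rightarrow> 'a set" where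
  "nbhd_of Z A e = (\<Union>a\<in>A. mball_of Z a e)"

definition levy_prokhorov :: "'a metric \<Rightarrow> 'a pmf \<Rightarrow> 'a pmf \<Rightarrow> real" where
  "levy_prokhorov Z \<mu> \<nu> = Inf {e. 0 < e \<and> (\<forall>A\<in>borel_sets_of Z.
      measure_pmf.prob \<mu> A \<le> measure_pmf.prob \<nu> (nbhd_of Z A e) + e \<and>
      measure_pmf.prob \<nu> A \<le> measure_pmf.prob \<mu> (nbhd_of Z A e) + e)}"

definition finsupp_measures :: "nat \<Rightarrow> 'a metric \<Rightarrow> 'a pmf set" where
  "finsupp_measures n Z = {\<mu>. set_pmf \<mu> \<subseteq> mspace Z \<and> finite (set_pmf \<mu>) \<and> card (set_pmf \<mu>) \<le> n}"

text \<open>A finite formal convex combination of points is a \<^typ>\<open>'a pmf\<close> with finite support: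
  the coefficient of \<open>z\<close> in \<open>\<mu>\<close> is \<^term>\<open>pmf \<mu> z\<close>, and the Dirac measure at \<open>z\<close> is
  \<^term>\<open>return_pmf z\<close>. As \<^const>\<open>metric\<close> is only meaningful on actual metric spaces, see
  \<open>Metric_space_levy_prokhorov\<close> below.\<close>

definition Bn :: "nat \<Rightarrow> 'a metric \<Rightarrow> 'a pmf metric" where
  "Bn n Z = metric (finsupp_measures n Z, levy_prokhorov Z)"

lemma Metric_space_levy_prokhorov: "Metric_space (finsupp_measures n Z) (levy_prokhorov Z)"
proof -
  interpret Z: Metric_space "mspace Z" "mdist Z"
    by simp
  define S where "S \<mu> \<nu> = {e. 0 < e \<and> (\<forall>A\<in>borel_sets_of Z.
      measure_pmf.prob \<mu> A \<le> measure_pmf.prob \<nu> (nbhd_of Z A e) + e \<and>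
      measure_pmf.prob \<nu> A \<le> measure_pmf.prob \<mu> (nbhd_of Z A e) + e)}" for \<mu> \<nu>
  have lp: "levy_prokhorov Z \<mu> \<nu> = Inf (S \<mu> \<nu>)" for \<mu> \<nu>
    unfolding levy_prokhorov_def S_def ..
  have one: "1 \<in> S \<mu> \<nu>" for \<mu> \<nu>
    unfolding S_def by (auto intro!: add_increasing[OF measure_nonneg])
  have bdd: "bdd_below (S \<mu> \<nu>)" for \<mu> \<nu>
    unfolding S_def by (rule bdd_belowI[of _ 0]) auto
  have nonneg: "0 \<le> levy_prokhorov Z \<mu> \<nu>" for \<mu> \<nu>
  proof -
    have "S \<mu> \<nu> \<noteq> {}"
      using one by blast
    then show ?thesis
      unfolding lp by (rule cInf_greatest) (simp add: S_def)
  qed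
  have sym: "levy_prokhorov Z \<mu> \<nu> = levy_prokhorov Z \<nu> \<mu>" for \<mu> \<nu>
    unfolding levy_prokhorov_def by (simp add: conj_commute)
  have close: "\<exists>e\<in>S \<mu> \<nu>. e < r" if "levy_prokhorov Z \<mu> \<nu> < r" for \<mu> \<nu> r
    using that one bdd unfolding lp by (metis cInf_less_iff empty_iff)
  have nb_open: "nbhd_of Z A e \<in> borel_sets_of Z" for A e
    unfolding borel_sets_of_def nbhd_of_def
    by (intro sigma_sets.Basic) (auto simp: mtopology_of_def mball_of_def)
  have refl: "levy_prokhorov Z \<mu> \<mu> = 0" if "\<mu> \<in> finsupp_measures n Z" for \<mu>
  proof -
    have "e \<in> S \<mu> \<mu>" if "0 < e" for e
    proof -
      have "measure_pmf.prob \<mu> A \<le> measure_pmf.prob \<mu> (nbhd_of Z A e) + e" if "A \<in> borel_sets_of Z" for A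
      proof -
        have "{U. openin (mtopology_of Z) U} \<subseteq> Pow (mspace Z)"
          by (metis (no_types, lifting) PowI mem_Collect_eq openin_subset subsetI topspace_mtopology_of)
        then have "A \<subseteq> mspace Z"
          using that sigma_sets_into_sp[of "{U. openin (mtopology_of Z) U}" "mspace Z" A]
          by (auto simp: borel_sets_of_def)
        then have "A \<subseteq> nbhd_of Z A e"
          using \<open>0 < e\<close> by (force simp: nbhd_of_def)
        then have "measure_pmf.prob \<mu> A \<le> measure_pmf.prob \<mu> (nbhd_of Z A e)"
          by (intro measure_pmf.finite_measure_mono) auto
        then show ?thesis
          using \<open>0 < e\<close> by simp
      qed
      then show ?thesis
        using \<open>0 < e\<close> by (auto simp: S_def)
    qed
    then have "levy_prokhorov Z \<mu> \<mu> \<le> 0 + e" if "0 < e" for e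
      using that bdd unfolding lp by (simp add: cInf_lower)
    then have "levy_prokhorov Z \<mu> \<mu> \<le> 0"
      using field_le_epsilon by blast
    then show ?thesis
      using nonneg by (simp add: antisym)
  qed
  have pmf_le: "pmf \<mu> x \<le> pmf \<nu> x"
    if d: "levy_prokhorov Z \<mu> \<nu> = 0" and \<mu>: "\<mu> \<in> finsupp_measures n Z"
      and \<nu>: "\<nu> \<in> finsupp_measures n Z" for \<mu> \<nu> x
  proof (cases "x \<in> mspace Z")
    case False
    then have "x \<notin> set_pmf \<mu>"
      using \<mu> unfolding finsupp_measures_def by blast
    then show ?thesis
      using pmf_eq_0_set_pmf[of \<mu> x] by simp
  next
    case True
    define D where "D = insert 1 (mdist Z x ` (set_pmf \<nu> - {x}))"
    have fin: "finite D"
      using \<nu> by (simp add: D_def finsupp_measures_def)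
    have "0 < mdist Z x y" if "y \<in> set_pmf \<nu> - {x}" for y
      using that \<nu> True Z.mdist_pos_less[of x y] by (auto simp: finsupp_measures_def)
    then have D0: "0 < Min D"
      using fin by (subst Min_gr_iff) (auto simp: D_def)
    have x_borel: "{x} \<in> borel_sets_of Z"
    proof -
      have "closedin (mtopology_of Z) {x}"
        using True closedin_Hausdorff_sing_eq[OF Z.Hausdorff_space_mtopology] by (simp add: mtopology_of_def)
      then have "openin (mtopology_of Z) (mspace Z - {x})"
        by (metis closedin_def topspace_mtopology_of)
      then have "mspace Z - (mspace Z - {x}) \<in> borel_sets_of Z"
        unfolding borel_sets_of_def by (intro sigma_sets.Compl sigma_sets.Basic) simp
      moreover have "mspace Z - (mspace Z - {x}) = {x}"
        using True by blast
      ultimately show ?thesis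
        by simp
    qed
    have "pmf \<mu> x \<le> pmf \<nu> x + r" if "0 < r" for r
    proof -
      obtain e where e: "e \<in> S \<mu> \<nu>" "e < min r (Min D)"
        using close[of \<mu> \<nu> "min r (Min D)"] d D0 \<open>0 < r\<close> by auto
      have "measure_pmf.prob \<mu> {x} \<le> measure_pmf.prob \<nu> (nbhd_of Z {x} e) + e"
        using e x_borel by (auto simp: S_def)
      also have "measure_pmf.prob \<nu> (nbhd_of Z {x} e) = measure_pmf.prob \<nu> (nbhd_of Z {x} e \<inter> set_pmf \<nu>)"
        by (simp add: measure_Int_set_pmf)
      also have "\<dots> \<le> measure_pmf.prob \<nu> {x}"
      proof (rule measure_pmf.finite_measure_mono)
        have "y = x" if y: "y \<in> set_pmf \<nu>" "mdist Z x y < e" for y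
        proof (rule ccontr)
          assume "y \<noteq> x"
          then have "mdist Z x y \<in> D"
            using y by (simp add: D_def)
          then have "Min D \<le> mdist Z x y"
            using fin by simp
          then show False
            using y e by simp
        qed
        then show "nbhd_of Z {x} e \<inter> set_pmf \<nu> \<subseteq> {x}"
          by (auto simp: nbhd_of_def)
      qed simp
      finally show ?thesis
        using e by (simp add: measure_pmf_single)
    qed
    then show ?thesis
      using field_le_epsilon by blast
  qed
  have tri: "levy_prokhorov Z \<mu> \<rho> \<le> levy_prokhorov Z \<mu> \<nu> + levy_prokhorov Z \<nu> \<rho>" for \<mu> \<nu> \<rho>
  proof (rule field_le_epsilon)
    fix r :: real assume "0 < r"
    obtain e where e: "e \<in> S \<mu> \<nu>" "e < levy_prokhorov Z \<mu> \<nu> + r / 2"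
      using close[of \<mu> \<nu> "levy_prokhorov Z \<mu> \<nu> + r / 2"] \<open>0 < r\<close> by auto
    obtain e' where e': "e' \<in> S \<nu> \<rho>" "e' < levy_prokhorov Z \<nu> \<rho> + r / 2"
      using close[of \<nu> \<rho> "levy_prokhorov Z \<nu> \<rho> + r / 2"] \<open>0 < r\<close> by auto
    have nb: "nbhd_of Z (nbhd_of Z A s) t \<subseteq> nbhd_of Z A (s + t)" for A s t
    proof
      fix y assume "y \<in> nbhd_of Z (nbhd_of Z A s) t"
      then obtain a b where ab: "a \<in> A" "b \<in> mball_of Z a s" "y \<in> mball_of Z b t"
        by (auto simp: nbhd_of_def)
      then have "y \<in> mball_of Z a (s + t)"
        using Z.triangle[of a b y] by auto
      then show "y \<in> nbhd_of Z A (s + t)"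
        using ab by (auto simp: nbhd_of_def)
    qed
    have nbm: "measure_pmf.prob \<sigma> (nbhd_of Z (nbhd_of Z A s) t) \<le> measure_pmf.prob \<sigma> (nbhd_of Z A (s + t))"
      for \<sigma> A s t
      using nb by (intro measure_pmf.finite_measure_mono) auto
    have "e + e' \<in> S \<mu> \<rho>"
    proof -
      have "measure_pmf.prob \<mu> A \<le> measure_pmf.prob \<rho> (nbhd_of Z A (e + e')) + (e + e')"
        if A: "A \<in> borel_sets_of Z" for A
      proof -
        have "measure_pmf.prob \<mu> A \<le> measure_pmf.prob \<nu> (nbhd_of Z A e) + e"
          using e A by (auto simp: S_def)
        moreover have "measure_pmf.prob \<nu> (nbhd_of Z A e) \<le>
            measure_pmf.prob \<rho> (nbhd_of Z (nbhd_of Z A e) e') + e'"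
          using e' nb_open by (auto simp: S_def)
        ultimately show ?thesis
          using nbm[of \<rho> A e e'] by linarith
      qed
      moreover have "measure_pmf.prob \<rho> A \<le> measure_pmf.prob \<mu> (nbhd_of Z A (e + e')) + (e + e')"
        if A: "A \<in> borel_sets_of Z" for A
      proof -
        have "measure_pmf.prob \<rho> A \<le> measure_pmf.prob \<nu> (nbhd_of Z A e') + e'"
          using e' A by (auto simp: S_def)
        moreover have "measure_pmf.prob \<nu> (nbhd_of Z A e') \<le>
            measure_pmf.prob \<mu> (nbhd_of Z (nbhd_of Z A e') e) + e"
          using e nb_open by (auto simp: S_def)
        ultimately show ?thesis
          using nbm[of \<mu> A e' e] by (simp add: add.commute)
      qed
      ultimately show ?thesis
        using e e' by (auto simp: S_def)
    qed
    then have "levy_prokhorov Z \<mu> \<rho> \<le> e + e'"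
      unfolding lp using bdd by (intro cInf_lower) auto
    then show "levy_prokhorov Z \<mu> \<rho> \<le> levy_prokhorov Z \<mu> \<nu> + levy_prokhorov Z \<nu> \<rho> + r"
      using e e' by linarith
  qed
  show ?thesis
  proof
    fix \<mu> \<nu> assume *: "\<mu> \<in> finsupp_measures n Z" "\<nu> \<in> finsupp_measures n Z"
    show "levy_prokhorov Z \<mu> \<nu> = 0 \<longleftrightarrow> \<mu> = \<nu>"
    proof
      assume d: "levy_prokhorov Z \<mu> \<nu> = 0"
      show "\<mu> = \<nu>"
        using pmf_le[OF d *] pmf_le[OF _ *(2,1)] d sym by (intro pmf_eqI antisym) auto
    qed (use refl * in auto)
  qed (rule nonneg sym tri)+
qed

lemma mspace_Bn [simp]: "mspace (Bn n Z) = finsupp_measures n Z"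
  and mdist_Bn [simp]: "mdist (Bn n Z) = levy_prokhorov Z"
  unfolding Bn_def
  using Metric_space_levy_prokhorov[of n Z]
  by (auto simp: Metric_space.mspace_metric Metric_space.mdist_metric)

text \<open>The push-forward along evaluation at \<open>t\<close> sends the convex combination of the paths
  \<open>\<alpha>\<close> to the convex combination of the points \<open>\<alpha> t\<close>, adding coefficients when points
  coincide.\<close>

definition Phi :: "(real \<Rightarrow> 'a) pmf \<Rightarrow> real \<Rightarrow> 'a pmf" where
  "Phi \<mu> = (\<lambda>t\<in>{0..1}. map_pmf (\<lambda>\<alpha>. \<alpha> t) \<mu>)"

definition resolvable_paths :: "nat \<Rightarrow> 'a metric \<Rightarrow> (real \<Rightarrow> 'a pmf) set" where
  "resolvable_paths n X = {f \<in> topspace (path_topology (mtopology_of (Bn n X))).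
      \<exists>\<mu> \<in> mspace (Bn n (path_metric X)). f = Phi \<mu>}"

definition RP0 :: "nat \<Rightarrow> 'a metric \<Rightarrow> 'a \<Rightarrow> (real \<Rightarrow> 'a pmf) topology" where
  "RP0 n X x0 = subtopology (path_topology (mtopology_of (Bn n X)))
      {f \<in> resolvable_paths n X. f 1 = return_pmf x0}"

text \<open>In \<^typ>\<open>enat\<close>, the infimum of the empty set is \<^term>\<open>\<infinity> :: enat\<close>.\<close>

definition icat :: "'a metric \<Rightarrow> 'a \<Rightarrow> enat" where
  "icat X x0 = Inf {enat n | n. \<exists>H. continuous_map (mtopology_of X) (RP0 (n + 1) X x0) H \<and>
      (\<forall>x \<in> mspace X. H x 0 = return_pmf x)}"

definition paths_to :: "'a metric \<Rightarrow> 'a \<Rightarrow> (real \<Rightarrow> 'a) metric" where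
  "paths_to X x0 = submetric (path_metric X) {\<gamma>. \<gamma> 1 = x0}"

definition paths_between :: "'a metric \<Rightarrow> 'a \<Rightarrow> 'a \<Rightarrow> (real \<Rightarrow> 'a) metric" where
  "paths_between X x x0 = submetric (path_metric X) {\<gamma>. \<gamma> 0 = x \<and> \<gamma> 1 = x0}"

definition dcat :: "'a metric \<Rightarrow> 'a \<Rightarrow> enat" where
  "dcat X x0 = Inf {enat n | n. \<exists>H.
      continuous_map (mtopology_of X) (mtopology_of (Bn (n + 1) (paths_to X x0))) H \<and>
      (\<forall>x \<in> mspace X. H x \<in> mspace (Bn (n + 1) (paths_between X x x0)))}"

definition contractible_in :: "'a topology \<Rightarrow> 'a set \<Rightarrow> bool" where
  "contractible_in X U \<longleftrightarrow>
     (\<exists>c \<in> topspace X. homotopic_with (\<lambda>_. True) (subtopology X U) X id (\<lambda>_. c))"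

definition LS_cat :: "'a topology \<Rightarrow> enat" where
  "LS_cat X = Inf {enat n | n. \<exists>U :: nat \<Rightarrow> 'a set.
      (\<forall>i\<le>n. openin X (U i) \<and> contractible_in X (U i)) \<and> topspace X = (\<Union>i\<le>n. U i)}"

text \<open>A metrizable space is an ANR if it is a neighbourhood retract of every metrizable space
  containing it as a closed subspace. As there is no quantification over types, the ambient spaces
  have their points in the type \<^typ>\<open>'a \<Rightarrow> real\<close>. This is no restriction: with \<open>d\<close> a bounded
  metric, \<open>x \<mapsto> d x\<close> embeds the space as a closed subspace of the convex hull of its
  image in the normed space of bounded functions (Wojdyslawski), and by Dugundji's theorem this
  convex set is an absolute extensor for metrizable spaces. So a neighbourhood retract of it is an
  absolute neighbourhood extensor for metrizable spaces, that is, an ANR in the usual sense.\<close>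

definition ANR_space :: "'a topology \<Rightarrow> bool" where
  "ANR_space X \<longleftrightarrow> metrizable_space X \<and>
     (\<forall>(Z :: ('a \<Rightarrow> real) topology) S.
        metrizable_space Z \<and> closedin Z S \<and> X homeomorphic_space subtopology Z S \<longrightarrow>
        (\<exists>V. openin Z V \<and> S \<subseteq> V \<and> S retract_of_space subtopology Z V))"

definition homotopy_domination :: "'a topology \<Rightarrow> 'b topology \<Rightarrow> ('a \<Rightarrow> 'b) \<Rightarrow> bool" where
  "homotopy_domination X Y f \<longleftrightarrow> continuous_map X Y f \<and>
     (\<exists>g. continuous_map Y X g \<and> homotopic_with (\<lambda>_. True) Y Y (f \<circ> g) id)"

text \<open>The wedge is realised as the union of the two axes in the product. It carries the quotient
  topology of the disjoint union, see \<open>openin_wedge_metric\<close>.\<close>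

definition wedge_metric :: "'a metric \<Rightarrow> 'a \<Rightarrow> 'b metric \<Rightarrow> 'b \<Rightarrow> ('a \<times> 'b) metric" where
  "wedge_metric X a Y b = submetric (prod_metric X Y) (mspace X \<times> {b} \<union> {a} \<times> mspace Y)"

lemma openin_wedge_metric:
  assumes a: "a \<in> mspace X" and b: "b \<in> mspace Y"
  shows "openin (mtopology_of (wedge_metric X a Y b)) W \<longleftrightarrow>
     W \<subseteq> mspace X \<times> {b} \<union> {a} \<times> mspace Y \<and>
     openin (mtopology_of X) {x \<in> mspace X. (x, b) \<in> W} \<and>
     openin (mtopology_of Y) {y \<in> mspace Y. (a, y) \<in> W}"  (is "?L \<longleftrightarrow> ?R")
proof -
  let ?T = "mspace X \<times> {b} \<union> {a} \<times> mspace Y"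
  let ?P = "prod_topology (mtopology_of X) (mtopology_of Y)"
  have top: "mtopology_of (wedge_metric X a Y b) = subtopology ?P ?T"
    by (simp add: wedge_metric_def mtopology_of_submetric mtopology_of_prod_metric)
  show ?thesis
  proof
    assume ?L
    then obtain V where V: "openin ?P V" "W = V \<inter> ?T"
      unfolding top openin_subtopology by blast
    have "continuous_map (mtopology_of X) ?P (\<lambda>x. (x, b))"
      and "continuous_map (mtopology_of Y) ?P (\<lambda>y. (a, y))"
      using a b by (auto intro!: continuous_map_pairedI)
    then have "openin (mtopology_of X) {x \<in> mspace X. (x, b) \<in> V}"
      "openin (mtopology_of Y) {y \<in> mspace Y. (a, y) \<in> V}"
      using V(1) by (force dest: openin_continuous_map_preimage)+
    moreover have "{x \<in> mspace X. (x, b) \<in> V} = {x \<in> mspace X. (x, b) \<in> W}"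
      "{y \<in> mspace Y. (a, y) \<in> V} = {y \<in> mspace Y. (a, y) \<in> W}"
      using V(2) by auto
    ultimately show ?R
      using V(2) by auto
  next
    assume R: ?R
    let ?U1 = "{x \<in> mspace X. (x, b) \<in> W}" and ?U2 = "{y \<in> mspace Y. (a, y) \<in> W}"
    show ?L
    proof (cases "(a, b) \<in> W")
      case True
      have "openin ?P (?U1 \<times> ?U2)"
        using R by (simp add: openin_prod_Times_iff)
      moreover have "W = (?U1 \<times> ?U2) \<inter> ?T"
        using R True a b by auto
      ultimately show ?thesis
        unfolding top openin_subtopology by blast
    next
      case False
      have "openin ?P (?U1 \<times> mspace Y \<union> mspace X \<times> ?U2)"
        using R openin_topspace[of "mtopology_of X"] openin_topspace[of "mtopology_of Y"]
        by (intro openin_Un) (simp_all add: openin_prod_Times_iff)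
      moreover have "W = (?U1 \<times> mspace Y \<union> mspace X \<times> ?U2) \<inter> ?T"
        using R False a b by auto
      ultimately show ?thesis
        unfolding top openin_subtopology by blast
    qed
  qed
qed

end

theory Submission
  imports Defs
begin

text \<open>All four parts become manageable once a continuous map \<open>X \<rightarrow> RP\<^sub>0(B\<^sub>m(X))\<close> is read as a deformation
\<open>G : I \<times> X \<rightarrow> B\<^sub>m(X)\<close> from the Dirac measures to the constant \<open>\<delta>\<^bsub>x0\<^esub>\<close> all of whose time
slices \<open>t \<mapsto> G (t, x)\<close> are resolved by a measure on paths. This is the exponential law for
the compact interval (\<open>icat_eq_Inf_resolvable_family\<close>). Such deformations can be pushed forward and
concatenated.

The Levy-Prokhorov distance enters through one estimate, \<open>levy_prokhorov_map_pmf_le\<close>: two images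
\<open>f M\<close> and \<open>g N\<close> are \<open>e\<close>-close if some relation transports all but \<open>e\<close> of the mass of \<open>M\<close> into
\<open>N\<close> and \<open>f\<close>, \<open>g\<close> differ by less than \<open>e\<close> on related points. It implies that pushing forward finitely
supported measures is jointly continuous in the measure and a parameter
(\<open>continuous_map_map_pmf\<close>), although the functions involved need not be uniformly continuous: only
the finitely many points of the limit measure matter.

\<open>icat \<le> dcat\<close>: evaluating a measure on paths at each time gives a resolvable deformation, and
evaluation is jointly continuous.

\<open>dcat \<le> cat\<close>: as \<open>X\<close> is path-connected, the contraction of each member \<open>U\<^sub>i\<close> of a categorical cover
can be made to end in \<open>x0\<close>, so that it gives a continuous choice \<open>a\<^sub>i x\<close> of a path from \<open>x \<in> U\<^sub>i\<close> to
\<open>x0\<close>. With a partition of unity \<open>w\<^sub>i\<close> subordinate to the cover, \<open>x \<mapsto> \<Sum> w\<^sub>i(x) a\<^sub>i x\<close> is the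
required map. Near a point with \<open>w\<^sub>i(x) = 0\<close> the path \<open>a\<^sub>i\<close> may vary wildly, but it carries little
mass (\<open>continuous_map_finite_mixture\<close>).

Domination: if \<open>f g \<simeq> id\<close> and \<open>G\<close> deforms \<open>X\<close>, then \<open>y \<in> Y\<close> first moves to \<open>f (g y)\<close> along the
homotopy, then spreads along \<open>f\<^sub>* G(t, g y)\<close> until all mass is in \<open>f x0\<close>, and finally moves along a
path to \<open>y0\<close>. The number of paths needed for a concatenation is at most the product of the
numbers for the pieces, and the first and last piece are single paths, so the bound for \<open>G\<close> survives
(\<open>resolvable_family_join\<close>). Since the last piece absorbs a change of basepoint, homotopy invariance
follows by applying this in both directions, and the inequality for wedges and products follows
because both retract onto \<open>X\<close> and onto \<open>Y\<close>.\<close>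

section \<open>Continuous maps into metric spaces and path spaces\<close>

lemma continuous_map_mtopology_of_iff:
  "continuous_map T (mtopology_of Z) f \<longleftrightarrow>
     (\<forall>x\<in>topspace T. f x \<in> mspace Z) \<and>
     (\<forall>x\<in>topspace T. \<forall>e>0. \<exists>U. openin T U \<and> x \<in> U \<and> (\<forall>y\<in>U. mdist Z (f x) (f y) < e))"
  (is "?L \<longleftrightarrow> ?R")
proof -
  interpret Z: Metric_space "mspace Z" "mdist Z"
    by simp
  have in_mspace: "f y \<in> mspace Z" if "y \<in> U" "openin T U" "\<forall>x\<in>topspace T. f x \<in> mspace Z" for y U
    using that openin_subset by blast
  have "continuous_map T Z.mtopology f \<Longrightarrow> \<forall>x\<in>topspace T. f x \<in> mspace Z"
    by (auto simp: continuous_map_def)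
  then have "continuous_map T Z.mtopology f \<longleftrightarrow> (\<forall>x\<in>topspace T. f x \<in> mspace Z) \<and>
      (\<forall>x\<in>topspace T. \<forall>e>0. \<exists>U. openin T U \<and> x \<in> U \<and> (\<forall>y\<in>U. f y \<in> Z.mball (f x) e))"
    unfolding Z.continuous_map_to_metric by blast
  also have "\<dots> \<longleftrightarrow> ?R"
    unfolding Z.in_mball using in_mspace by (intro conj_cong refl ball_cong all_cong ex_cong1) blast
  finally show ?thesis
    unfolding mtopology_of_def .
qed

lemma continuous_map_mtopology_ofI:
  assumes "\<And>x. x \<in> topspace T \<Longrightarrow> f x \<in> mspace Z"
    and "\<And>x e. x \<in> topspace T \<Longrightarrow> 0 < e \<Longrightarrow> \<exists>U. openin T U \<and> x \<in> U \<and> (\<forall>y\<in>U. mdist Z (f x) (f y) \<le> e)"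
  shows "continuous_map T (mtopology_of Z) f"
  unfolding continuous_map_mtopology_of_iff
proof (intro conjI ballI allI impI)
  fix x and e :: real assume "x \<in> topspace T" "0 < e"
  then obtain U where "openin T U" "x \<in> U" "\<forall>y\<in>U. mdist Z (f x) (f y) \<le> e / 2"
    using assms(2)[of x "e / 2"] by auto
  then show "\<exists>U. openin T U \<and> x \<in> U \<and> (\<forall>y\<in>U. mdist Z (f x) (f y) < e)"
    using \<open>0 < e\<close> by (intro exI[of _ U]) (auto simp: less_le_trans intro: le_less_trans)
qed (use assms in auto)

lemma continuous_map_mtopology_ofE:
  assumes "continuous_map T (mtopology_of Z) f" "x \<in> topspace T" "0 < e"
  obtains U where "openin T U" "x \<in> U" "\<And>y. y \<in> U \<Longrightarrow> mdist Z (f x) (f y) < e"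
proof -
  have "\<exists>U. openin T U \<and> x \<in> U \<and> (\<forall>y\<in>U. mdist Z (f x) (f y) < e)"
    using assms(1)[unfolded continuous_map_mtopology_of_iff, THEN conjunct2] assms(2,3) by simp
  then show ?thesis
    using that by blast
qed

lemma continuous_map_in_mspace:
  assumes "continuous_map T (mtopology_of Z) f" "x \<in> topspace T"
  shows "f x \<in> mspace Z"
  using assms by (auto simp: continuous_map_def)

lemma mspace_path_metric:
  "mspace (path_metric Z) = {f. continuous_map unit_interval (mtopology_of Z) f \<and> f \<in> extensional {0..1}}"
proof -
  have "mspace (path_metric Z) = topspace (path_topology (mtopology_of Z))"
    by (metis mtopology_of_path_metric topspace_mtopology_of)
  then show ?thesis
    by (simp add: path_topology_def topspace_compact_open_topology)
qed

lemma mdist_path_metric_le: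
  assumes "0 \<le> e" "\<And>t. t \<in> {0..1} \<Longrightarrow> mdist Z (f t) (g t) \<le> e"
  shows "mdist (path_metric Z) f g \<le> e"
  unfolding path_metric_def using assms by (intro mdist_cfunspace_le) auto

lemma mdist_le_path_metric:
  assumes "f \<in> mspace (path_metric Z)" "g \<in> mspace (path_metric Z)" "t \<in> {0..1}"
  shows "mdist Z (f t) (g t) \<le> mdist (path_metric Z) f g"
  using mdist_cfunspace_imp_mdist_le[OF assms(1,2)[unfolded path_metric_def] order_refl] assms(3)
  by (simp add: path_metric_def)

lemma path_metric_in_mspace:
  assumes "f \<in> mspace (path_metric Z)" "t \<in> {0..1}"
  shows "f t \<in> mspace Z"
  using assms continuous_map_image_subset_topspace[of unit_interval "mtopology_of Z" f]
  by (auto simp: mspace_path_metric)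

text \<open>By the tube lemma, the open set of points \<open>(t, y)\<close> with \<open>h (t, y)\<close> within \<open>e\<close> of \<open>h (t, x)\<close> contains a
tube \<open>I \<times> U\<close> around \<open>I \<times> {x}\<close>, and closeness at all times is closeness in the uniform metric.\<close>

lemma continuous_map_curry_path:
  assumes "continuous_map (prod_topology unit_interval T) (mtopology_of Z) h"
  shows "continuous_map T (mtopology_of (path_metric Z)) (\<lambda>x. \<lambda>t\<in>{0..1}. h (t, x))"
proof (rule continuous_map_mtopology_ofI)
  fix x assume x: "x \<in> topspace T"
  have "continuous_map unit_interval (mtopology_of Z) (h \<circ> (\<lambda>t. (t, x)))"
    using x by (intro continuous_map_compose[OF _ assms] continuous_map_pairedI) auto
  then have "continuous_map unit_interval (mtopology_of Z) (\<lambda>t\<in>{0..1}. h (t, x))"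
    by (rule continuous_map_eq) auto
  then show "(\<lambda>t\<in>{0..1}. h (t, x)) \<in> mspace (path_metric Z)"
    by (auto simp: mspace_path_metric)
  fix e :: real assume e: "0 < e"
  interpret Z: Metric_space "mspace Z" "mdist Z"
    by simp
  have hm: "h p \<in> mspace Z" if "p \<in> topspace (prod_topology unit_interval T)" for p
    using assms that unfolding continuous_map_mtopology_of_iff by blast
  have "openin (prod_topology unit_interval T) {q \<in> topspace (prod_topology unit_interval T).
      mdist Z (h (fst q, x)) (h q) < e}" (is "openin _ ?V")
  proof -
    have "continuous_map (prod_topology unit_interval T) (mtopology_of Z) (\<lambda>q. h (fst q, x))"
      by (rule continuous_map_compose[OF _ assms, of _ "\<lambda>q. (fst q, x)", unfolded o_def])
        (use x in \<open>auto intro!: continuous_map_pairedI continuous_map_fst\<close>)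
    then have "continuous_map (prod_topology unit_interval T) euclidean (\<lambda>q. mdist Z (h (fst q, x)) (h q))"
      using assms by (rule continuous_map_mdist)
    then have "openin (prod_topology unit_interval T) {q \<in> topspace (prod_topology unit_interval T).
      mdist Z (h (fst q, x)) (h q) \<in> {..<e}}"
      by (rule openin_continuous_map_preimage) auto
    then show ?thesis
      by simp
  qed
  moreover have "{0..1} \<times> {x} \<subseteq> ?V"
    using x e hm by auto
  moreover have "compactin unit_interval {0..1}"
    by (simp add: compactin_subtopology)
  moreover have "compactin T {x}"
    using x by simp
  ultimately obtain A U where A: "openin unit_interval A" "openin T U" "{0..1} \<subseteq> A" "{x} \<subseteq> U" "A \<times> U \<subseteq> ?V"
    using tube_lemma_left[of unit_interval T ?V "{0..1}" x] x by auto
  have "mdist (path_metric Z) (\<lambda>t\<in>{0..1}. h (t, x)) (\<lambda>t\<in>{0..1}. h (t, y)) \<le> e" if "y \<in> U" for y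
    using A that e by (intro mdist_path_metric_le) force+
  then show "\<exists>U. openin T U \<and> x \<in> U \<and> (\<forall>y\<in>U. mdist (path_metric Z) (\<lambda>t\<in>{0..1}. h (t, x)) (\<lambda>t\<in>{0..1}. h (t, y)) \<le> e)"
    using A by auto
qed

lemma continuous_map_path_eval:
  "continuous_map (prod_topology unit_interval (mtopology_of (path_metric Z))) (mtopology_of Z) (\<lambda>(t, \<alpha>). \<alpha> t)"
proof (rule continuous_map_mtopology_ofI)
  interpret Z: Metric_space "mspace Z" "mdist Z"
    by simp
  interpret P: Metric_space "mspace (path_metric Z)" "mdist (path_metric Z)"
    by simp
  fix p assume "p \<in> topspace (prod_topology unit_interval (mtopology_of (path_metric Z)))"
  then obtain t \<alpha> where p: "p = (t, \<alpha>)" "t \<in> {0..1}" "\<alpha> \<in> mspace (path_metric Z)"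
    by auto
  then show "(case p of (t, \<alpha>) \<Rightarrow> \<alpha> t) \<in> mspace Z"
    by (simp add: path_metric_in_mspace)
  fix e :: real assume e: "0 < e"
  have "continuous_map unit_interval (mtopology_of Z) \<alpha>"
    using p by (simp add: mspace_path_metric)
  then obtain A where A: "openin unit_interval A" "t \<in> A" "\<And>s. s \<in> A \<Longrightarrow> mdist Z (\<alpha> t) (\<alpha> s) < e / 2"
    by (rule continuous_map_mtopology_ofE[where x = t and e = "e / 2"]) (use p e in auto)
  have A01: "A \<subseteq> {0..1}"
    using openin_subset[OF A(1)] by simp
  let ?U = "A \<times> mball_of (path_metric Z) \<alpha> (e / 2)"
  have "mdist Z (\<alpha> t) (\<beta> s) \<le> e" if "s \<in> A" "\<beta> \<in> mball_of (path_metric Z) \<alpha> (e / 2)" for s \<beta>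
  proof -
    have s: "s \<in> {0..1}" and b: "\<beta> \<in> mspace (path_metric Z)"
      using that A01 by auto
    have "mdist Z (\<alpha> t) (\<beta> s) \<le> mdist Z (\<alpha> t) (\<alpha> s) + mdist Z (\<alpha> s) (\<beta> s)"
      using p s b by (intro Z.triangle) (auto simp: path_metric_in_mspace)
    also have "mdist Z (\<alpha> s) (\<beta> s) \<le> mdist (path_metric Z) \<alpha> \<beta>"
      using p s b by (intro mdist_le_path_metric)
    finally show ?thesis
      using A(3)[OF that(1)] that(2) by simp
  qed
  moreover have "openin (prod_topology unit_interval (mtopology_of (path_metric Z))) ?U"
    using A(1) by (simp add: openin_prod_Times_iff mtopology_of_def mball_of_def)
  ultimately show "\<exists>U. openin (prod_topology unit_interval (mtopology_of (path_metric Z))) U \<and> p \<in> U \<and>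
      (\<forall>q\<in>U. mdist Z (case p of (t, \<alpha>) \<Rightarrow> \<alpha> t) (case q of (t, \<alpha>) \<Rightarrow> \<alpha> t) \<le> e)"
    using A p e by (intro exI[of _ ?U]) auto
qed

section \<open>The Levy-Prokhorov metric on finitely supported measures\<close>

text \<open>The defining inequality for Borel sets extends to every set \<open>A\<close>, because only the finite
intersection of \<open>A\<close> with the support of \<open>\<mu>\<close> matters and a finite set is closed.\<close>

lemma levy_prokhorov_lessD:
  assumes fin: "finite (set_pmf \<mu>)" and sub: "set_pmf \<mu> \<subseteq> mspace Z"
    and less: "levy_prokhorov Z \<mu> \<nu> < e"
  shows "measure_pmf.prob \<mu> A \<le> measure_pmf.prob \<nu> (nbhd_of Z A e) + e"
proof -
  interpret Z: Metric_space "mspace Z" "mdist Z"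
    by simp
  define S where "S = {e. 0 < e \<and> (\<forall>A\<in>borel_sets_of Z.
      measure_pmf.prob \<mu> A \<le> measure_pmf.prob \<nu> (nbhd_of Z A e) + e \<and>
      measure_pmf.prob \<nu> A \<le> measure_pmf.prob \<mu> (nbhd_of Z A e) + e)}"
  have "1 \<in> S"
    unfolding S_def by (auto intro!: add_increasing[OF measure_nonneg])
  moreover have "bdd_below S"
    unfolding S_def by (rule bdd_belowI[of _ 0]) auto
  ultimately obtain r where r: "r \<in> S" "r < e"
    using less unfolding levy_prokhorov_def S_def[symmetric] by (metis cInf_less_iff empty_iff)
  let ?B = "A \<inter> set_pmf \<mu>"
  have "closedin (mtopology_of Z) ?B"
    unfolding mtopology_of_def using fin sub
    by (intro closedin_Hausdorff_finite Z.Hausdorff_space_mtopology) auto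
  then have "mspace Z - (mspace Z - ?B) \<in> borel_sets_of Z"
    unfolding borel_sets_of_def
    by (intro sigma_sets.Compl sigma_sets.Basic) (simp add: closedin_def)
  moreover have "mspace Z - (mspace Z - ?B) = ?B"
    using sub by blast
  ultimately have "measure_pmf.prob \<mu> ?B \<le> measure_pmf.prob \<nu> (nbhd_of Z ?B r) + r"
    using r by (simp add: S_def)
  moreover have "nbhd_of Z ?B r \<subseteq> nbhd_of Z A e"
    using r by (force simp: nbhd_of_def)
  then have "measure_pmf.prob \<nu> (nbhd_of Z ?B r) \<le> measure_pmf.prob \<nu> (nbhd_of Z A e)"
    by (intro measure_pmf.finite_measure_mono) auto
  ultimately show ?thesis
    using r by (simp add: measure_Int_set_pmf)
qed

text \<open>One of the two inequalities in the definition suffices: the reverse one for \<open>A\<close> is the given one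
for the complement of the \<open>e\<close>-neighbourhood of \<open>A\<close>, whose own \<open>e\<close>-neighbourhood misses \<open>A\<close>.\<close>

lemma levy_prokhorov_leI:
  assumes e: "0 < e" and \<mu>: "set_pmf \<mu> \<subseteq> mspace Z" and \<nu>: "set_pmf \<nu> \<subseteq> mspace Z"
    and le: "\<And>A. A \<subseteq> set_pmf \<mu> \<Longrightarrow> measure_pmf.prob \<mu> A \<le> measure_pmf.prob \<nu> (nbhd_of Z A e) + e"
  shows "levy_prokhorov Z \<mu> \<nu> \<le> e"
proof -
  interpret Z: Metric_space "mspace Z" "mdist Z"
    by simp
  have one: "measure_pmf.prob \<mu> A \<le> measure_pmf.prob \<nu> (nbhd_of Z A e) + e" for A
  proof -
    have "measure_pmf.prob \<mu> A = measure_pmf.prob \<mu> (A \<inter> set_pmf \<mu>)"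
      by (simp add: measure_Int_set_pmf)
    also have "\<dots> \<le> measure_pmf.prob \<nu> (nbhd_of Z (A \<inter> set_pmf \<mu>) e) + e"
      by (rule le) simp
    also have "measure_pmf.prob \<nu> (nbhd_of Z (A \<inter> set_pmf \<mu>) e) \<le> measure_pmf.prob \<nu> (nbhd_of Z A e)"
      by (intro measure_pmf.finite_measure_mono) (auto simp: nbhd_of_def)
    finally show ?thesis
      by simp
  qed
  have two: "measure_pmf.prob \<nu> A \<le> measure_pmf.prob \<mu> (nbhd_of Z A e) + e" for A
  proof -
    let ?C = "- nbhd_of Z A e"
    have "nbhd_of Z ?C e \<inter> A = {}"
      using Z.commute by (fastforce simp: nbhd_of_def)
    then have "measure_pmf.prob \<nu> A \<le> measure_pmf.prob \<nu> (- nbhd_of Z ?C e)"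
      by (intro measure_pmf.finite_measure_mono) auto
    also have "\<dots> = 1 - measure_pmf.prob \<nu> (nbhd_of Z ?C e)"
      by (subst measure_pmf.prob_compl[symmetric]) (auto simp: Compl_eq_Diff_UNIV)
    also have "\<dots> \<le> 1 - measure_pmf.prob \<mu> ?C + e"
      using one[of ?C] by simp
    also have "1 - measure_pmf.prob \<mu> ?C = measure_pmf.prob \<mu> (nbhd_of Z A e)"
      by (subst measure_pmf.prob_compl[symmetric]) (auto simp: Compl_eq_Diff_UNIV[symmetric])
    finally show ?thesis .
  qed
  show ?thesis
    unfolding levy_prokhorov_def using e one two
    by (intro cInf_lower bdd_belowI[of _ 0]) auto
qed

text \<open>A coupling estimate. The transport condition is one-sided, so only points in the support of \<open>M\<close>
have to be controlled; points of \<open>N\<close> that are related to nothing do no harm.\<close>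

lemma levy_prokhorov_map_pmf_le:
  assumes e: "0 < e" and f: "f ` set_pmf M \<subseteq> mspace Z" and g: "g ` set_pmf N \<subseteq> mspace Z"
    and le: "\<And>A. A \<subseteq> set_pmf M \<Longrightarrow>
      measure_pmf.prob M A \<le> measure_pmf.prob N {y. \<exists>x\<in>A. R x y} + e"
    and R: "\<And>x y. x \<in> set_pmf M \<Longrightarrow> y \<in> set_pmf N \<Longrightarrow> R x y \<Longrightarrow> mdist Z (f x) (g y) < e"
  shows "levy_prokhorov Z (map_pmf f M) (map_pmf g N) \<le> e"
proof (rule levy_prokhorov_leI[OF e])
  fix A
  let ?A = "{x \<in> set_pmf M. f x \<in> A}"
  have "measure_pmf.prob (map_pmf f M) A = measure_pmf.prob M (f -` A \<inter> set_pmf M)"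
    by (simp add: measure_Int_set_pmf)
  also have "f -` A \<inter> set_pmf M = ?A"
    by auto
  also have "measure_pmf.prob M ?A \<le> measure_pmf.prob N {y. \<exists>x\<in>?A. R x y} + e"
    by (rule le) auto
  also have "measure_pmf.prob N {y. \<exists>x\<in>?A. R x y} =
      measure_pmf.prob N ({y. \<exists>x\<in>?A. R x y} \<inter> set_pmf N)"
    by (simp add: measure_Int_set_pmf)
  also have "\<dots> \<le> measure_pmf.prob N (g -` nbhd_of Z A e)"
    using R f g by (intro measure_pmf.finite_measure_mono) (fastforce simp: nbhd_of_def)+
  finally show "measure_pmf.prob (map_pmf f M) A \<le> measure_pmf.prob (map_pmf g N) (nbhd_of Z A e) + e"
    by simp
qed (use f g in simp_all)

lemma map_pmf_in_finsupp_measures: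
  assumes "\<mu> \<in> finsupp_measures n W" "f ` set_pmf \<mu> \<subseteq> mspace Z"
  shows "map_pmf f \<mu> \<in> finsupp_measures n Z"
  using assms by (auto simp: finsupp_measures_def intro: order_trans[OF card_image_le])

text \<open>At \<open>(t, \<mu>)\<close> it is enough to control \<open>F\<close> near the finitely many points \<open>(t, x)\<close> with \<open>x\<close> in the
support of \<open>\<mu>\<close>, which gives a common radius \<open>\<delta>\<close>. The choice \<open>\<delta> \<le> e\<close> makes \<open>\<delta>\<close>-closeness of measures
supply the transport condition of the coupling estimate.\<close>

lemma continuous_map_map_pmf:
  assumes F: "continuous_map (prod_topology T (mtopology_of W)) (mtopology_of Z) F"
  shows "continuous_map (prod_topology T (mtopology_of (Bn n W))) (mtopology_of (Bn n Z))
    (\<lambda>(t, \<mu>). map_pmf (\<lambda>w. F (t, w)) \<mu>)"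
proof (rule continuous_map_mtopology_ofI)
  interpret W: Metric_space "mspace W" "mdist W"
    by simp
  interpret B: Metric_space "finsupp_measures n W" "levy_prokhorov W"
    by (rule Metric_space_levy_prokhorov)
  have FZ: "F (t, w) \<in> mspace Z" if "t \<in> topspace T" "w \<in> mspace W" for t w
    using F that unfolding continuous_map_mtopology_of_iff by simp
  have supp: "w \<in> mspace W" if "w \<in> set_pmf \<mu>" "\<mu> \<in> finsupp_measures n W" for w \<mu>
    using that by (auto simp: finsupp_measures_def)
  fix p assume "p \<in> topspace (prod_topology T (mtopology_of (Bn n W)))"
  then obtain t \<mu> where p: "p = (t, \<mu>)" "t \<in> topspace T" "\<mu> \<in> finsupp_measures n W"
    by auto
  show "(case p of (t, \<mu>) \<Rightarrow> map_pmf (\<lambda>w. F (t, w)) \<mu>) \<in> mspace (Bn n Z)"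
    using p by (auto intro!: map_pmf_in_finsupp_measures FZ supp)
  fix e :: real assume e: "0 < e"
  let ?S = "set_pmf \<mu>"
  have fin: "finite ?S"
    using p by (simp add: finsupp_measures_def)
  have "\<exists>V d. openin T V \<and> t \<in> V \<and> 0 < d \<and>
      (\<forall>s\<in>V. \<forall>w\<in>mspace W. mdist W x w < d \<longrightarrow> mdist Z (F (t, x)) (F (s, w)) < e)" if x: "x \<in> ?S" for x
  proof -
    have "(t, x) \<in> topspace (prod_topology T (mtopology_of W))"
      using p x supp by simp
    then obtain U where U: "openin (prod_topology T (mtopology_of W)) U" "(t, x) \<in> U"
        "\<And>q. q \<in> U \<Longrightarrow> mdist Z (F (t, x)) (F q) < e"
      by (rule continuous_map_mtopology_ofE[OF F _ e]) blast
    then obtain V O' where V: "openin T V" "openin (mtopology_of W) O'" "t \<in> V" "x \<in> O'" "V \<times> O' \<subseteq> U"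
      unfolding openin_prod_topology_alt by meson
    then obtain d where "0 < d" "W.mball x d \<subseteq> O'"
      unfolding mtopology_of_def W.openin_mtopology by blast
    then show ?thesis
      using U V supp[OF x p(3)] by (intro exI[of _ V] exI[of _ d]) (auto simp: subset_iff)
  qed
  then obtain V d where V: "\<And>x. x \<in> ?S \<Longrightarrow> openin T (V x) \<and> t \<in> V x \<and> 0 < d x \<and>
      (\<forall>s\<in>V x. \<forall>w\<in>mspace W. mdist W x w < d x \<longrightarrow> mdist Z (F (t, x)) (F (s, w)) < e)"
    by metis
  define \<delta> where "\<delta> = Min (insert e (d ` ?S))"
  have \<delta>: "0 < \<delta>" "\<delta> \<le> e" "\<And>x. x \<in> ?S \<Longrightarrow> \<delta> \<le> d x"
    using fin e V by (auto simp: \<delta>_def)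
  define U where "U = (topspace T \<inter> (\<Inter>x\<in>?S. V x)) \<times> B.mball \<mu> \<delta>"
  have "openin T (topspace T \<inter> (\<Inter>x\<in>?S. V x))"
    using openin_INT[OF fin, of T V] V by (simp add: Int_commute)
  moreover have "openin (mtopology_of (Bn n W)) (B.mball \<mu> \<delta>)"
    by (simp add: mtopology_of_def)
  ultimately have "openin (prod_topology T (mtopology_of (Bn n W))) U"
    by (simp add: U_def openin_prod_Times_iff)
  moreover have "p \<in> U"
    using p V \<delta> by (simp add: U_def)
  moreover have "levy_prokhorov Z (map_pmf (\<lambda>w. F (t, w)) \<mu>) (map_pmf (\<lambda>w. F (s, w)) \<nu>) \<le> e"
    if q: "(s, \<nu>) \<in> U" for s \<nu>
  proof (rule levy_prokhorov_map_pmf_le[OF e, where R = "\<lambda>x y. x \<in> mspace W \<and> y \<in> mspace W \<and> mdist W x y < \<delta>"])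
    show "(\<lambda>w. F (t, w)) ` set_pmf \<mu> \<subseteq> mspace Z" "(\<lambda>w. F (s, w)) ` set_pmf \<nu> \<subseteq> mspace Z"
      using q p by (auto simp: U_def intro!: FZ supp)
    fix A
    have "levy_prokhorov W \<mu> \<nu> < \<delta>"
      using q by (simp add: U_def)
    then have "measure_pmf.prob \<mu> A \<le> measure_pmf.prob \<nu> (nbhd_of W A \<delta>) + \<delta>"
      using p(3) fin by (intro levy_prokhorov_lessD) (simp_all add: finsupp_measures_def)
    moreover have "nbhd_of W A \<delta> = {y. \<exists>x\<in>A. x \<in> mspace W \<and> y \<in> mspace W \<and> mdist W x y < \<delta>}"
      by (auto simp: nbhd_of_def)
    ultimately show "measure_pmf.prob \<mu> A \<le>
        measure_pmf.prob \<nu> {y. \<exists>x\<in>A. x \<in> mspace W \<and> y \<in> mspace W \<and> mdist W x y < \<delta>} + e"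
      using \<delta>(2) by simp
  next
    fix x y assume "x \<in> ?S" "x \<in> mspace W \<and> y \<in> mspace W \<and> mdist W x y < \<delta>"
    then show "mdist Z (F (t, x)) (F (s, y)) < e"
      using V \<delta>(3) q by (force simp: U_def)
  qed
  ultimately show "\<exists>U. openin (prod_topology T (mtopology_of (Bn n W))) U \<and> p \<in> U \<and> (\<forall>q\<in>U.
      mdist (Bn n Z) (case p of (t, \<mu>) \<Rightarrow> map_pmf (\<lambda>w. F (t, w)) \<mu>)
        (case q of (t, \<mu>) \<Rightarrow> map_pmf (\<lambda>w. F (t, w)) \<mu>) \<le> e)"
    using p by (intro exI[of _ U]) auto
qed

section \<open>Concatenation and resolvable families\<close>

lemma continuous_map_join:
  assumes k: "continuous_map (prod_topology unit_interval T) M k"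
    and l: "continuous_map (prod_topology unit_interval T) M l"
    and kl: "\<And>x. x \<in> topspace T \<Longrightarrow> k (1, x) = l (0, x)"
  shows "continuous_map (prod_topology unit_interval T) M
    (\<lambda>(t, x). if t \<le> 1/2 then k (2 * t, x) else l (2 * t - 1, x))"
proof -
  let ?P = "prod_topology unit_interval T"
  have fst: "continuous_map (subtopology ?P S) euclideanreal fst" for S
    by (intro continuous_map_from_subtopology continuous_map_into_fulltopology[OF continuous_map_fst])
  have "continuous_map ?P M (\<lambda>p. if fst p \<le> 1/2 then k (2 * fst p, snd p) else l (2 * fst p - 1, snd p))"
  proof (rule continuous_map_cases_le)
    show "continuous_map ?P euclideanreal fst" "continuous_map ?P euclideanreal (\<lambda>p. 1/2)"
      by (auto intro: continuous_map_into_fulltopology[OF continuous_map_fst])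
    let ?L = "subtopology ?P {p \<in> topspace ?P. fst p \<le> 1/2}"
    have "continuous_map ?L ?P (\<lambda>p. (2 * fst p, snd p))"
      by (intro continuous_map_pairedI continuous_map_into_subtopology continuous_map_real_mult
          continuous_map_from_subtopology continuous_map_snd continuous_map_into_fulltopology[OF continuous_map_fst])
        auto
    then show "continuous_map ?L M (\<lambda>p. k (2 * fst p, snd p))"
      using continuous_map_compose[OF _ k] by (auto simp: o_def)
    let ?R = "subtopology ?P {p \<in> topspace ?P. 1/2 \<le> fst p}"
    have "continuous_map ?R ?P (\<lambda>p. (2 * fst p - 1, snd p))"
      by (intro continuous_map_pairedI continuous_map_into_subtopology continuous_map_real_mult
          continuous_map_diff
          continuous_map_from_subtopology continuous_map_snd continuous_map_into_fulltopology[OF continuous_map_fst])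
        auto
    then show "continuous_map ?R M (\<lambda>p. l (2 * fst p - 1, snd p))"
      using continuous_map_compose[OF _ l] by (auto simp: o_def)
    fix p assume p: "p \<in> topspace ?P" "fst p = 1/2"
    then have "2 * fst p = 1" "snd p \<in> topspace T"
      by auto
    then show "k (2 * fst p, snd p) = l (2 * fst p - 1, snd p)"
      using kl[of "snd p"] by simp
  qed
  then show ?thesis
    by (simp add: case_prod_unfold)
qed

definition join_paths :: "(real \<Rightarrow> 'a) \<Rightarrow> (real \<Rightarrow> 'a) \<Rightarrow> real \<Rightarrow> 'a" where
  "join_paths \<alpha> \<beta> = (\<lambda>t\<in>{0..1}. if t \<le> 1/2 then \<alpha> (2 * t) else \<beta> (2 * t - 1))"

lemma join_paths_in_path_metric:
  assumes "\<alpha> \<in> mspace (path_metric Z)" "\<beta> \<in> mspace (path_metric Z)" "\<alpha> 1 = \<beta> 0"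
  shows "join_paths \<alpha> \<beta> \<in> mspace (path_metric Z)"
proof -
  \<comment> \<open>A path is a family of paths over a point.\<close>
  let ?I = "prod_topology unit_interval (discrete_topology {()})"
  have "continuous_map ?I (mtopology_of Z) (\<alpha> \<circ> fst)" "continuous_map ?I (mtopology_of Z) (\<beta> \<circ> fst)"
    using assms by (auto intro!: continuous_map_compose[OF continuous_map_fst] simp: mspace_path_metric)
  then have "continuous_map (discrete_topology {()}) (mtopology_of (path_metric Z))
      (\<lambda>x. \<lambda>t\<in>{0..1}. (\<lambda>(t, x). if t \<le> 1/2 then (\<alpha> \<circ> fst) (2 * t, x) else (\<beta> \<circ> fst) (2 * t - 1, x)) (t, x))"
    using assms by (intro continuous_map_curry_path continuous_map_join) (auto simp: o_def)
  moreover have "() \<in> topspace (discrete_topology {()})"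
    by simp
  ultimately have "(\<lambda>t\<in>{0..1}. (\<lambda>(t, x). if t \<le> 1/2 then (\<alpha> \<circ> fst) (2 * t, x) else (\<beta> \<circ> fst) (2 * t - 1, x)) (t, ()))
      \<in> mspace (path_metric Z)"
    by (rule continuous_map_in_mspace)
  then show ?thesis
    by (simp add: join_paths_def cong: if_cong)
qed

text \<open>The uncurried form of a continuous family of resolvable paths. The endpoints are left free, so
that families can be concatenated and pushed forward.\<close>

definition resolvable_family :: "nat \<Rightarrow> 'b topology \<Rightarrow> 'a metric \<Rightarrow> (real \<times> 'b \<Rightarrow> 'a pmf) \<Rightarrow> bool" where
  "resolvable_family n T Z G \<longleftrightarrow>
     continuous_map (prod_topology unit_interval T) (mtopology_of (Bn n Z)) G \<and>
     (\<forall>x\<in>topspace T. \<exists>\<mu>\<in>finsupp_measures n (path_metric Z).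
        \<forall>t\<in>{0..1}. G (t, x) = map_pmf (\<lambda>\<alpha>. \<alpha> t) \<mu>)"

lemma icat_eq_Inf_resolvable_family:
  "icat X x0 = Inf {enat n | n. \<exists>G. resolvable_family (n + 1) (mtopology_of X) X G \<and>
     (\<forall>x\<in>mspace X. G (0, x) = return_pmf x \<and> G (1, x) = return_pmf x0)}"
proof -
  have "(\<exists>H. continuous_map (mtopology_of X) (RP0 m X x0) H \<and> (\<forall>x\<in>mspace X. H x 0 = return_pmf x)) \<longleftrightarrow>
      (\<exists>G. resolvable_family m (mtopology_of X) X G \<and>
        (\<forall>x\<in>mspace X. G (0, x) = return_pmf x \<and> G (1, x) = return_pmf x0))"
    (is "?L \<longleftrightarrow> ?R") for m
  proof
    assume ?L
    then obtain H where H: "continuous_map (mtopology_of X) (RP0 m X x0) H"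
        "\<And>x. x \<in> mspace X \<Longrightarrow> H x 0 = return_pmf x"
      by blast
    have c: "continuous_map (mtopology_of X) (mtopology_of (path_metric (Bn m X))) H"
      and r: "\<And>x. x \<in> mspace X \<Longrightarrow> H x \<in> resolvable_paths m X \<and> H x 1 = return_pmf x0"
      using H(1) unfolding RP0_def continuous_map_in_subtopology mtopology_of_path_metric by auto
    have "continuous_map (prod_topology unit_interval (mtopology_of X))
        (prod_topology unit_interval (mtopology_of (path_metric (Bn m X)))) (\<lambda>p. (fst p, H (snd p)))"
      by (intro continuous_map_pairedI continuous_map_fst
          continuous_map_compose[OF continuous_map_snd c, unfolded o_def])
    from continuous_map_compose[OF this continuous_map_path_eval]
    have "continuous_map (prod_topology unit_interval (mtopology_of X)) (mtopology_of (Bn m X)) (\<lambda>(t, x). H x t)"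
      by (simp add: o_def case_prod_unfold)
    moreover have "\<exists>\<mu>\<in>finsupp_measures m (path_metric X). \<forall>t\<in>{0..1}. H x t = map_pmf (\<lambda>\<alpha>. \<alpha> t) \<mu>"
      if "x \<in> mspace X" for x
      using r[OF that] unfolding resolvable_paths_def Phi_def by auto
    ultimately show ?R
      using H(2) r by (intro exI[of _ "\<lambda>(t, x). H x t"]) (simp add: resolvable_family_def)
  next
    assume ?R
    then obtain G where G: "continuous_map (prod_topology unit_interval (mtopology_of X)) (mtopology_of (Bn m X)) G"
        "\<And>x. x \<in> mspace X \<Longrightarrow> \<exists>\<mu>\<in>finsupp_measures m (path_metric X). \<forall>t\<in>{0..1}. G (t, x) = map_pmf (\<lambda>\<alpha>. \<alpha> t) \<mu>"
        "\<And>x. x \<in> mspace X \<Longrightarrow> G (0, x) = return_pmf x \<and> G (1, x) = return_pmf x0"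
      unfolding resolvable_family_def by auto
    define H where "H = (\<lambda>x. \<lambda>t\<in>{0..1}. G (t, x))"
    have c: "continuous_map (mtopology_of X) (path_topology (mtopology_of (Bn m X))) H"
      using continuous_map_curry_path[OF G(1)] by (simp add: H_def mtopology_of_path_metric)
    have "H x \<in> resolvable_paths m X" if x: "x \<in> mspace X" for x
    proof -
      obtain \<mu> where "\<mu> \<in> finsupp_measures m (path_metric X)" "\<forall>t\<in>{0..1}. G (t, x) = map_pmf (\<lambda>\<alpha>. \<alpha> t) \<mu>"
        using G(2)[OF x] by blast
      moreover from this have "H x = Phi \<mu>"
        by (auto simp: H_def Phi_def)
      ultimately show ?thesis
        using continuous_map_image_subset_topspace[OF c] x unfolding resolvable_paths_def by auto
    qed
    then have "continuous_map (mtopology_of X) (RP0 m X x0) H"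
      using c G(3) unfolding RP0_def continuous_map_in_subtopology by (auto simp: H_def)
    then show ?L
      using G(3) by (intro exI[of _ H]) (auto simp: H_def)
  qed
  then show ?thesis
    unfolding icat_def by simp
qed

text \<open>A moving Dirac measure is resolved by the single path it follows.\<close>

lemma resolvable_family_return:
  assumes h: "continuous_map (prod_topology unit_interval T) (mtopology_of Z) h"
  shows "resolvable_family 1 T Z (\<lambda>p. return_pmf (h p))"
  unfolding resolvable_family_def
proof (intro conjI ballI)
  show "continuous_map (prod_topology unit_interval T) (mtopology_of (Bn 1 Z)) (\<lambda>p. return_pmf (h p))"
  proof (rule continuous_map_mtopology_ofI)
    have hZ: "h p \<in> mspace Z" if "p \<in> topspace (prod_topology unit_interval T)" for p
      using h that unfolding continuous_map_mtopology_of_iff by blast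
    fix p assume p: "p \<in> topspace (prod_topology unit_interval T)"
    then show "return_pmf (h p) \<in> mspace (Bn 1 Z)"
      using hZ by (simp add: finsupp_measures_def)
    fix e :: real assume e: "0 < e"
    obtain U where U: "openin (prod_topology unit_interval T) U" "p \<in> U" "\<And>q. q \<in> U \<Longrightarrow> mdist Z (h p) (h q) < e"
      by (rule continuous_map_mtopology_ofE[OF h p e]) blast
    have "levy_prokhorov Z (return_pmf (h p)) (return_pmf (h q)) \<le> e" if q: "q \<in> U" for q
    proof -
      have "q \<in> topspace (prod_topology unit_interval T)"
        using openin_subset[OF U(1)] q by blast
      then have "levy_prokhorov Z (map_pmf (\<lambda>_. h p) (return_pmf ())) (map_pmf (\<lambda>_. h q) (return_pmf ())) \<le> e"
        using e U(3)[OF q] hZ[of q] hZ[OF p]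
        by (intro levy_prokhorov_map_pmf_le[where R = "(=)"]) auto
      then show ?thesis
        by simp
    qed
    then show "\<exists>U. openin (prod_topology unit_interval T) U \<and> p \<in> U \<and>
        (\<forall>q\<in>U. mdist (Bn 1 Z) (return_pmf (h p)) (return_pmf (h q)) \<le> e)"
      using U by (intro exI[of _ U]) simp
  qed
  fix x assume x: "x \<in> topspace T"
  have "(\<lambda>t\<in>{0..1}. h (t, x)) \<in> mspace (path_metric Z)"
    using continuous_map_curry_path[OF h] x unfolding continuous_map_mtopology_of_iff by blast
  then show "\<exists>\<mu>\<in>finsupp_measures 1 (path_metric Z). \<forall>t\<in>{0..1}. return_pmf (h (t, x)) = map_pmf (\<lambda>\<alpha>. \<alpha> t) \<mu>"
    by (intro bexI[of _ "return_pmf (\<lambda>t\<in>{0..1}. h (t, x))"]) (simp_all add: finsupp_measures_def)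
qed

lemma resolvable_family_map:
  assumes G: "resolvable_family n T Z G"
    and f: "continuous_map (mtopology_of Z) (mtopology_of Z') f" and g: "continuous_map T' T g"
  shows "resolvable_family n T' Z' (\<lambda>(t, y). map_pmf f (G (t, g y)))"
  unfolding resolvable_family_def
proof (intro conjI ballI)
  let ?P = "prod_topology unit_interval T'"
  have "continuous_map ?P (prod_topology unit_interval T) (\<lambda>p. (fst p, g (snd p)))"
    by (intro continuous_map_pairedI continuous_map_fst continuous_map_compose[OF continuous_map_snd g, unfolded o_def])
  then have "continuous_map ?P (mtopology_of (Bn n Z)) (G \<circ> (\<lambda>p. (fst p, g (snd p))))"
    using G unfolding resolvable_family_def by (blast intro: continuous_map_compose)
  then have "continuous_map ?P (prod_topology ?P (mtopology_of (Bn n Z))) (\<lambda>p. (p, G (fst p, g (snd p))))"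
    by (intro continuous_map_pairedI) (auto simp: o_def)
  moreover have "continuous_map (prod_topology ?P (mtopology_of (Bn n Z))) (mtopology_of (Bn n Z'))
      (\<lambda>(p, \<mu>). map_pmf (\<lambda>w. (f \<circ> snd) (p, w)) \<mu>)"
    by (intro continuous_map_map_pmf continuous_map_compose[OF continuous_map_snd f])
  ultimately have "continuous_map ?P (mtopology_of (Bn n Z'))
      ((\<lambda>(p, \<mu>). map_pmf (\<lambda>w. (f \<circ> snd) (p, w)) \<mu>) \<circ> (\<lambda>p. (p, G (fst p, g (snd p)))))"
    by (rule continuous_map_compose)
  then show "continuous_map ?P (mtopology_of (Bn n Z')) (\<lambda>(t, y). map_pmf f (G (t, g y)))"
    by (simp add: o_def case_prod_unfold)
  fix y assume "y \<in> topspace T'"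
  then have "g y \<in> topspace T"
    using continuous_map_image_subset_topspace[OF g] by blast
  then obtain \<mu> where \<mu>: "\<mu> \<in> finsupp_measures n (path_metric Z)"
      "\<And>t. t \<in> {0..1} \<Longrightarrow> G (t, g y) = map_pmf (\<lambda>\<alpha>. \<alpha> t) \<mu>"
    using G unfolding resolvable_family_def by blast
  let ?f = "\<lambda>\<alpha>. \<lambda>t\<in>{0..1}. f (\<alpha> t)"
  have "?f \<alpha> \<in> mspace (path_metric Z')" if "\<alpha> \<in> set_pmf \<mu>" for \<alpha>
  proof -
    have "continuous_map unit_interval (mtopology_of Z) \<alpha>"
      using that \<mu>(1) by (auto simp: finsupp_measures_def mspace_path_metric)
    from continuous_map_compose[OF this f]
    have "continuous_map unit_interval (mtopology_of Z') (?f \<alpha>)"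
      by (rule continuous_map_eq) auto
    then show ?thesis
      by (simp add: mspace_path_metric)
  qed
  then have "map_pmf ?f \<mu> \<in> finsupp_measures n (path_metric Z')"
    using \<mu>(1) by (intro map_pmf_in_finsupp_measures) auto
  then show "\<exists>\<mu>\<in>finsupp_measures n (path_metric Z'). \<forall>t\<in>{0..1}.
      (case (t, y) of (t, y) \<Rightarrow> map_pmf f (G (t, g y))) = map_pmf (\<lambda>\<alpha>. \<alpha> t) \<mu>"
    using \<mu>(2) by (intro bexI[of _ "map_pmf ?f \<mu>"]) (auto simp: map_pmf_comp)
qed

lemma continuous_map_Bn_change_bound:
  assumes "continuous_map T (mtopology_of (Bn m Z)) f" "\<And>x. x \<in> topspace T \<Longrightarrow> f x \<in> finsupp_measures n Z"
  shows "continuous_map T (mtopology_of (Bn n Z)) f"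
  using assms unfolding continuous_map_mtopology_of_iff by simp

text \<open>If all mass of \<open>G (_, x)\<close> ends at the point where \<open>H (_, x)\<close> starts, every path resolving the first
can be followed by every path resolving the second. Choosing both independently gives a product
measure with at most \<open>m * n\<close> paths, whose marginals are the two given measures.\<close>

lemma resolvable_family_join:
  assumes G: "resolvable_family m T Z G" and H: "resolvable_family n T Z H"
    and c: "\<And>x. x \<in> topspace T \<Longrightarrow> G (1, x) = return_pmf (c x) \<and> H (0, x) = return_pmf (c x)"
  shows "resolvable_family (m * n) T Z
    (\<lambda>(t, x). if t \<le> 1/2 then G (2 * t, x) else H (2 * t - 1, x))"  (is "resolvable_family _ _ _ ?J")
proof -
  have res: "\<exists>\<mu>\<in>finsupp_measures (m * n) (path_metric Z). \<forall>t\<in>{0..1}. ?J (t, x) = map_pmf (\<lambda>\<alpha>. \<alpha> t) \<mu>"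
    if x: "x \<in> topspace T" for x
  proof -
    obtain \<mu> where \<mu>: "\<mu> \<in> finsupp_measures m (path_metric Z)"
        "\<And>t. t \<in> {0..1} \<Longrightarrow> G (t, x) = map_pmf (\<lambda>\<alpha>. \<alpha> t) \<mu>"
      using G x unfolding resolvable_family_def by blast
    obtain \<nu> where \<nu>: "\<nu> \<in> finsupp_measures n (path_metric Z)"
        "\<And>t. t \<in> {0..1} \<Longrightarrow> H (t, x) = map_pmf (\<lambda>\<alpha>. \<alpha> t) \<nu>"
      using H x unfolding resolvable_family_def by blast
    have "map_pmf (\<lambda>\<alpha>. \<alpha> 1) \<mu> = return_pmf (c x)" "map_pmf (\<lambda>\<alpha>. \<alpha> 0) \<nu> = return_pmf (c x)"
      using \<mu>(2)[of 1] \<nu>(2)[of 0] c[OF x] by simp_all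
    then have ends: "\<alpha> 1 = \<beta> 0" if "\<alpha> \<in> set_pmf \<mu>" "\<beta> \<in> set_pmf \<nu>" for \<alpha> \<beta>
      using that by (metis (mono_tags, lifting) map_pmf_eq_return_pmf_iff)
    let ?\<rho> = "map_pmf (\<lambda>(\<alpha>, \<beta>). join_paths \<alpha> \<beta>) (pair_pmf \<mu> \<nu>)"
    have "card (set_pmf ?\<rho>) \<le> card (set_pmf \<mu> \<times> set_pmf \<nu>)"
      using \<mu>(1) \<nu>(1) unfolding set_map_pmf set_pair_pmf
      by (intro card_image_le finite_cartesian_product) (simp_all add: finsupp_measures_def)
    also have "\<dots> \<le> m * n"
      using \<mu>(1) \<nu>(1) by (auto simp: finsupp_measures_def card_cartesian_product intro: mult_le_mono)
    finally have "?\<rho> \<in> finsupp_measures (m * n) (path_metric Z)"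
      using \<mu>(1) \<nu>(1) ends by (auto simp: finsupp_measures_def intro!: join_paths_in_path_metric)
    moreover have "?J (t, x) = map_pmf (\<lambda>\<alpha>. \<alpha> t) ?\<rho>" if t: "t \<in> {0..1}" for t
    proof (cases "t \<le> 1/2")
      case True
      then have "map_pmf (\<lambda>\<alpha>. \<alpha> t) ?\<rho> = map_pmf (\<lambda>\<alpha>. \<alpha> (2 * t)) (map_pmf fst (pair_pmf \<mu> \<nu>))"
        using t by (simp add: map_pmf_comp join_paths_def case_prod_unfold)
      then show ?thesis
        using True t \<mu>(2)[of "2 * t"] by (simp add: map_fst_pair_pmf)
    next
      case False
      then have "map_pmf (\<lambda>\<alpha>. \<alpha> t) ?\<rho> = map_pmf (\<lambda>\<beta>. \<beta> (2 * t - 1)) (map_pmf snd (pair_pmf \<mu> \<nu>))"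
        using t by (simp add: map_pmf_comp join_paths_def case_prod_unfold)
      then show ?thesis
        using False t \<nu>(2)[of "2 * t - 1"] by (simp add: map_snd_pair_pmf)
    qed
    ultimately show ?thesis
      by blast
  qed
  let ?P = "prod_topology unit_interval T"
  have "?J p \<in> finsupp_measures (m * n) Z" if p: "p \<in> topspace ?P" for p
  proof -
    obtain t x where tx: "p = (t, x)" "t \<in> {0..1}" "x \<in> topspace T"
      using p by auto
    then obtain \<rho> where \<rho>: "\<rho> \<in> finsupp_measures (m * n) (path_metric Z)" "?J p = map_pmf (\<lambda>\<alpha>. \<alpha> t) \<rho>"
      using res by blast
    have "(\<lambda>\<alpha>. \<alpha> t) ` set_pmf \<rho> \<subseteq> mspace Z"
      using \<rho>(1) tx path_metric_in_mspace by (auto simp: finsupp_measures_def)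
    then show ?thesis
      unfolding \<rho>(2) by (rule map_pmf_in_finsupp_measures[OF \<rho>(1)])
  qed
  \<comment> \<open>The two families take values in spaces with different bounds on the support; the bound \<open>m + n\<close>
      serves as a common one, and continuity does not depend on the bound.\<close>
  moreover have "continuous_map ?P (mtopology_of (Bn (m + n) Z)) ?J"
  proof (rule continuous_map_join)
    have G': "continuous_map ?P (mtopology_of (Bn m Z)) G" and H': "continuous_map ?P (mtopology_of (Bn n Z)) H"
      using G H by (simp_all add: resolvable_family_def)
    have "finsupp_measures m Z \<subseteq> finsupp_measures (m + n) Z" "finsupp_measures n Z \<subseteq> finsupp_measures (m + n) Z"
      by (auto simp: finsupp_measures_def)
    then show "continuous_map ?P (mtopology_of (Bn (m + n) Z)) G" "continuous_map ?P (mtopology_of (Bn (m + n) Z)) H"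
      using continuous_map_in_mspace[OF G'] continuous_map_in_mspace[OF H'] unfolding mspace_Bn
      by (intro continuous_map_Bn_change_bound[OF G'] continuous_map_Bn_change_bound[OF H']; blast)+
  qed (simp add: c)
  ultimately have "continuous_map ?P (mtopology_of (Bn (m * n) Z)) ?J"
    by (blast intro: continuous_map_Bn_change_bound)
  with res show ?thesis
    by (simp only: resolvable_family_def) blast
qed

section \<open>Homotopy dominations\<close>

lemma icat_le_of_homotopy_domination:
  assumes f: "homotopy_domination (mtopology_of X) (mtopology_of Y) f"
    and conn: "path_connected_space (mtopology_of Y)" and x0: "x0 \<in> mspace X" and y0: "y0 \<in> mspace Y"
  shows "icat Y y0 \<le> icat X x0"
proof -
  let ?TY = "mtopology_of Y"
  let ?PY = "prod_topology unit_interval ?TY"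
  obtain g where cf: "continuous_map (mtopology_of X) ?TY f" and cg: "continuous_map ?TY (mtopology_of X) g"
      and "homotopic_with (\<lambda>_. True) ?TY ?TY (f \<circ> g) id"
    using f unfolding homotopy_domination_def by blast
  then have "homotopic_with (\<lambda>_. True) ?TY ?TY id (f \<circ> g)"
    by (simp add: homotopic_with_symD)
  then obtain h where h: "continuous_map ?PY ?TY h" "\<And>y. h (0, y) = y" "\<And>y. h (1, y) = f (g y)"
    unfolding homotopic_with_def by auto
  have "f x0 \<in> mspace Y"
    using continuous_map_image_subset_topspace[OF cf] x0 by auto
  then obtain p where p: "pathin ?TY p" "p 0 = f x0" "p 1 = y0"
    using conn y0 unfolding path_connected_space_def by auto
  have p': "continuous_map ?PY ?TY (p \<circ> fst)"
    using p(1) unfolding pathin_def by (rule continuous_map_compose[OF continuous_map_fst])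
  have "\<exists>G'. resolvable_family m ?TY Y G' \<and>
      (\<forall>y\<in>mspace Y. G' (0, y) = return_pmf y \<and> G' (1, y) = return_pmf y0)"
    if G: "resolvable_family m (mtopology_of X) X G"
      and ends: "\<forall>x\<in>mspace X. G (0, x) = return_pmf x \<and> G (1, x) = return_pmf x0" for m G
  proof -
    have gX: "g y \<in> mspace X" if "y \<in> mspace Y" for y
      using continuous_map_image_subset_topspace[OF cg] that by auto
    \<comment> \<open>\<open>K\<close> is the transported deformation, starting at \<open>f (g y)\<close>; \<open>L\<close> prepends the homotopy from \<open>y\<close>
      to \<open>f (g y)\<close>, and \<open>N\<close> appends the path from \<open>f x0\<close> to \<open>y0\<close>.\<close>
    define K where "K = (\<lambda>(t, y). map_pmf f (G (t, g y)))"
    have K: "resolvable_family m ?TY Y K"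
      unfolding K_def by (rule resolvable_family_map[OF G cf cg])
    define L where "L = (\<lambda>(t, y). if t \<le> 1/2 then return_pmf (h (2 * t, y)) else K (2 * t - 1, y))"
    have L: "resolvable_family (1 * m) ?TY Y L"
      unfolding L_def
      by (rule resolvable_family_join[OF resolvable_family_return[OF h(1)] K, where c = "\<lambda>y. f (g y)"])
        (use h ends gX in \<open>auto simp: K_def\<close>)
    define N where "N = (\<lambda>(t, y). if t \<le> 1/2 then L (2 * t, y) else return_pmf ((p \<circ> fst) (2 * t - 1, y)))"
    have "resolvable_family (1 * m * 1) ?TY Y N"
      unfolding N_def
      by (rule resolvable_family_join[OF L resolvable_family_return[OF p'], where c = "\<lambda>_. f x0"])
        (use ends gX p in \<open>auto simp: L_def K_def\<close>)
    moreover have "N (0, y) = return_pmf y \<and> N (1, y) = return_pmf y0" for y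
      using h p by (simp add: N_def L_def)
    ultimately show ?thesis
      by auto
  qed
  then show ?thesis
    unfolding icat_eq_Inf_resolvable_family by (intro Inf_superset_mono) blast
qed

section \<open>Comparison with dcat and with the Lusternik-Schnirelmann category\<close>

text \<open>Evaluation of paths is jointly continuous in time and path, hence so is the evaluation of measures
on paths.\<close>

lemma icat_le_dcat: "icat X x0 \<le> dcat X x0"
proof -
  have "\<exists>G. resolvable_family m (mtopology_of X) X G \<and>
      (\<forall>x\<in>mspace X. G (0, x) = return_pmf x \<and> G (1, x) = return_pmf x0)"
    if H: "continuous_map (mtopology_of X) (mtopology_of (Bn m (paths_to X x0))) H"
      and ends: "\<forall>x\<in>mspace X. H x \<in> mspace (Bn m (paths_between X x x0))" for m H
  proof -
    let ?P = "prod_topology unit_interval (mtopology_of X)"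
    let ?W = "mtopology_of (paths_to X x0)"
    have "continuous_map (prod_topology unit_interval ?W) (mtopology_of X) (\<lambda>(t, \<alpha>). \<alpha> t)"
      unfolding paths_to_def mtopology_of_submetric prod_topology_subtopology(2)
      by (intro continuous_map_from_subtopology continuous_map_path_eval)
    from continuous_map_map_pmf[OF this]
    have "continuous_map (prod_topology unit_interval (mtopology_of (Bn m (paths_to X x0))))
        (mtopology_of (Bn m X)) (\<lambda>(t, \<mu>). map_pmf (\<lambda>\<alpha>. \<alpha> t) \<mu>)"
      by simp
    moreover have "continuous_map ?P (prod_topology unit_interval (mtopology_of (Bn m (paths_to X x0))))
        (\<lambda>p. (fst p, H (snd p)))"
      by (intro continuous_map_pairedI continuous_map_fst
          continuous_map_compose[OF continuous_map_snd H, unfolded o_def])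
    ultimately have "continuous_map ?P (mtopology_of (Bn m X))
        ((\<lambda>(t, \<mu>). map_pmf (\<lambda>\<alpha>. \<alpha> t) \<mu>) \<circ> (\<lambda>p. (fst p, H (snd p))))"
      by (rule continuous_map_compose[rotated])
    then have "continuous_map ?P (mtopology_of (Bn m X)) (\<lambda>(t, x). map_pmf (\<lambda>\<alpha>. \<alpha> t) (H x))"
      by (simp add: o_def case_prod_unfold)
    moreover have "H x \<in> finsupp_measures m (path_metric X)" if "x \<in> mspace X" for x
      using ends that by (auto simp: finsupp_measures_def paths_between_def)
    moreover have "map_pmf (\<lambda>\<alpha>. \<alpha> 0) (H x) = return_pmf x \<and> map_pmf (\<lambda>\<alpha>. \<alpha> 1) (H x) = return_pmf x0"
      if x: "x \<in> mspace X" for x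
    proof -
      have "\<alpha> 0 = x \<and> \<alpha> 1 = x0" if "\<alpha> \<in> set_pmf (H x)" for \<alpha>
        using ends x that by (auto simp: finsupp_measures_def paths_between_def)
      then have "map_pmf (\<lambda>\<alpha>. \<alpha> 0) (H x) = map_pmf (\<lambda>_. x) (H x)"
          "map_pmf (\<lambda>\<alpha>. \<alpha> 1) (H x) = map_pmf (\<lambda>_. x0) (H x)"
        by (intro map_pmf_cong refl; simp)+
      then show ?thesis
        by (simp add: map_pmf_const)
    qed
    ultimately show ?thesis
      by (intro exI[of _ "\<lambda>(t, x). map_pmf (\<lambda>\<alpha>. \<alpha> t) (H x)"]) (auto simp: resolvable_family_def)
  qed
  then show ?thesis
    unfolding icat_eq_Inf_resolvable_family dcat_def by (intro Inf_superset_mono) blast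
qed

text \<open>The distance to the complement of \<open>U\<close>, or a positive constant if the complement is empty. Such
functions, normalised by their sum, form the partition of unity for an open cover.\<close>

lemma openin_metric_cozero_set:
  assumes U: "openin (mtopology_of Z) U"
  obtains \<phi> :: "'a \<Rightarrow> real" where "continuous_map (mtopology_of Z) euclideanreal \<phi>"
    and "\<And>x. 0 \<le> \<phi> x" and "\<And>x. x \<in> mspace Z \<Longrightarrow> 0 < \<phi> x \<longleftrightarrow> x \<in> U"
proof (cases "mspace Z \<subseteq> U")
  case True
  then show ?thesis
    using that[of "\<lambda>_. 1"] by auto
next
  case False
  interpret Z: Metric_space "mspace Z" "mdist Z"
    by simp
  let ?C = "mspace Z - U"
  define \<phi> where "\<phi> x = (INF y\<in>?C. mdist Z x y)" for x
  have ne: "?C \<noteq> {}"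
    using False by blast
  have lower: "\<phi> x \<le> mdist Z x y" if "y \<in> ?C" for x y
    unfolding \<phi>_def using that by (intro cINF_lower bdd_belowI[of _ 0]) auto
  have nonneg: "0 \<le> \<phi> x" for x
    unfolding \<phi>_def using ne by (intro cINF_greatest) auto
  have Lip: "\<phi> x \<le> mdist Z x x' + \<phi> x'" if "x \<in> mspace Z" "x' \<in> mspace Z" for x x'
  proof -
    have "\<phi> x - mdist Z x x' \<le> \<phi> x'"
      unfolding \<phi>_def[of x']
    proof (rule cINF_greatest[OF ne])
      fix y assume y: "y \<in> ?C"
      then show "\<phi> x - mdist Z x x' \<le> mdist Z x' y"
        using lower[OF y, of x] Z.triangle[of x x' y] that by auto
    qed
    then show ?thesis
      by simp
  qed
  have "continuous_map (mtopology_of Z) (mtopology_of euclidean_metric) \<phi>"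
  proof (rule continuous_map_mtopology_ofI)
    fix x and e :: real assume x: "x \<in> topspace (mtopology_of Z)" and e: "0 < e"
    have "dist (\<phi> x) (\<phi> y) \<le> e" if "y \<in> mball_of Z x e" for y
      using Lip[of x y] Lip[of y x] that Z.commute[of x y] by (auto simp: dist_real_def)
    moreover have "openin (mtopology_of Z) (mball_of Z x e)"
      by (simp add: mtopology_of_def mball_of_def)
    ultimately show "\<exists>U. openin (mtopology_of Z) U \<and> x \<in> U \<and> (\<forall>y\<in>U. mdist euclidean_metric (\<phi> x) (\<phi> y) \<le> e)"
      using x e by (intro exI[of _ "mball_of Z x e"]) auto
  qed auto
  then have "continuous_map (mtopology_of Z) euclideanreal \<phi>"
    by simp
  moreover have "0 < \<phi> x \<longleftrightarrow> x \<in> U" if x: "x \<in> mspace Z" for x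
  proof
    show "x \<in> U" if "0 < \<phi> x"
      using lower[of x x] x that by auto
    assume "x \<in> U"
    then obtain r where r: "0 < r" "Z.mball x r \<subseteq> U"
      using U unfolding mtopology_of_def Z.openin_mtopology by blast
    have "r \<le> \<phi> x"
      unfolding \<phi>_def
    proof (rule cINF_greatest[OF ne])
      show "r \<le> mdist Z x y" if "y \<in> ?C" for y
        using r(2) that x by (force simp: not_less)
    qed
    then show "0 < \<phi> x"
      using r by simp
  qed
  ultimately show ?thesis
    using that nonneg by blast
qed

lemma finite_pmf_exists:
  fixes w :: "'i \<Rightarrow> real"
  assumes fin: "finite I" and nonneg: "\<And>i. i \<in> I \<Longrightarrow> 0 \<le> w i" and sum: "sum w I = 1"
  obtains p where "set_pmf p = {i \<in> I. 0 < w i}" and "\<And>i. i \<in> I \<Longrightarrow> pmf p i = w i"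
proof -
  let ?f = "\<lambda>i. if i \<in> I then w i else 0"
  have f: "0 \<le> ?f i" for i
    using nonneg by simp
  have "(\<integral>\<^sup>+ i. ennreal (?f i) \<partial>count_space UNIV) = (\<Sum>i\<in>I. ennreal (?f i))"
    using fin by (intro nn_integral_count_space') auto
  also have "\<dots> = ennreal (\<Sum>i\<in>I. ?f i)"
    using f by (intro sum_ennreal)
  also have "\<dots> = 1"
    using sum by simp
  finally have total: "(\<integral>\<^sup>+ i. ennreal (?f i) \<partial>count_space UNIV) = 1" .
  have pmf: "pmf (embed_pmf ?f) i = ?f i" for i
    by (rule pmf_embed_pmf[OF f total])
  moreover have "set_pmf (embed_pmf ?f) = {i \<in> I. 0 < w i}"
    using nonneg by (force simp: set_embed_pmf[OF f total])
  ultimately show ?thesis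
    using that by auto
qed

text \<open>The maps \<open>a i\<close> need only be defined and continuous where they can have positive weight. At \<open>x\<close> only
the indices of positive weight are compared. The weights vary continuously, so nearby points give
these indices almost all of the mass, and the coupling estimate along equal indices ignores the
others.\<close>

lemma continuous_map_finite_mixture:
  fixes L :: "'x \<Rightarrow> 'i pmf"
  assumes fin: "finite I" and card: "card I \<le> n"
    and L: "\<And>x. x \<in> topspace T \<Longrightarrow> set_pmf (L x) \<subseteq> {i \<in> I. x \<in> U i}"
    and cont: "\<And>i. i \<in> I \<Longrightarrow> continuous_map T euclideanreal (\<lambda>x. pmf (L x) i)"
    and U: "\<And>i. i \<in> I \<Longrightarrow> openin T (U i)"
    and a: "\<And>i. i \<in> I \<Longrightarrow> continuous_map (subtopology T (U i)) (mtopology_of Z) (a i)"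
  shows "continuous_map T (mtopology_of (Bn n Z)) (\<lambda>x. map_pmf (\<lambda>i. a i x) (L x))"
proof (rule continuous_map_mtopology_ofI)
  have aZ: "(\<lambda>i. a i x) ` set_pmf (L x) \<subseteq> mspace Z" if x: "x \<in> topspace T" for x
  proof
    fix z assume "z \<in> (\<lambda>i. a i x) ` set_pmf (L x)"
    then obtain i where "i \<in> I" "x \<in> U i" "z = a i x"
      using L[OF x] by blast
    then show "z \<in> mspace Z"
      using continuous_map_in_mspace[OF a] x by auto
  qed
  fix x assume x: "x \<in> topspace T"
  have "finite (set_pmf (L x))" "card (set_pmf (L x)) \<le> n"
    using L[OF x] fin card by (auto intro: finite_subset order_trans[OF card_mono])
  then show "map_pmf (\<lambda>i. a i x) (L x) \<in> mspace (Bn n Z)"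
    using aZ[OF x] by (auto simp: finsupp_measures_def intro: order_trans[OF card_image_le])
  fix e :: real assume e: "0 < e"
  let ?S = "set_pmf (L x)"
  \<comment> \<open>The successor avoids dividing by the cardinality of an empty index set.\<close>
  define \<delta> where "\<delta> = e / (card I + 1)"
  have \<delta>: "0 < \<delta>" "card I * \<delta> \<le> e"
    using e by (auto simp: \<delta>_def field_simps)
  have "\<exists>N. openin T N \<and> x \<in> N \<and> (\<forall>y\<in>N. mdist Z (a i x) (a i y) < e)" if i: "i \<in> ?S" for i
  proof -
    have iI: "i \<in> I" and "x \<in> topspace (subtopology T (U i))"
      using i L[OF x] x by auto
    then obtain N where "openin (subtopology T (U i)) N" "x \<in> N" "\<And>y. y \<in> N \<Longrightarrow> mdist Z (a i x) (a i y) < e"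
      using continuous_map_mtopology_ofE[OF a[OF iI] _ e] by metis
    then show ?thesis
      using openin_trans_full U[OF iI] by blast
  qed
  then obtain N where N: "\<And>i. i \<in> ?S \<Longrightarrow> openin T (N i) \<and> x \<in> N i \<and> (\<forall>y\<in>N i. mdist Z (a i x) (a i y) < e)"
    by metis
  define V where "V i = {y \<in> topspace T. pmf (L y) i \<in> {pmf (L x) i - \<delta> <..}}" for i
  have V: "openin T (V i)" if "i \<in> ?S" for i
    unfolding V_def using cont that L[OF x] by (intro openin_continuous_map_preimage) auto
  define W where "W = (\<Inter>i\<in>?S. N i \<inter> V i) \<inter> topspace T"
  have finS: "finite ?S"
    using L[OF x] fin by (auto intro: finite_subset)
  have "openin T W"
    unfolding W_def using finS N V by (intro openin_INT) auto
  moreover have "x \<in> W"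
    using N x \<delta> by (auto simp: W_def V_def)
  moreover have "levy_prokhorov Z (map_pmf (\<lambda>i. a i x) (L x)) (map_pmf (\<lambda>i. a i y) (L y)) \<le> e" if y: "y \<in> W" for y
  proof (rule levy_prokhorov_map_pmf_le[OF e, where R = "(=)"])
    show "(\<lambda>i. a i x) ` set_pmf (L x) \<subseteq> mspace Z" "(\<lambda>i. a i y) ` set_pmf (L y) \<subseteq> mspace Z"
      using x y by (auto simp: W_def intro!: aZ)
    show "mdist Z (a i x) (a j y) < e" if "i \<in> ?S" "i = j" for i j
      using that N y by (auto simp: W_def)
    fix A assume A: "A \<subseteq> ?S"
    then have "finite A"
      using finS finite_subset by blast
    then have "measure_pmf.prob (L x) A = (\<Sum>i\<in>A. pmf (L x) i)"
      by (rule measure_measure_pmf_finite)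
    also have "\<dots> \<le> (\<Sum>i\<in>A. pmf (L y) i + \<delta>)"
      using A y by (intro sum_mono) (force simp: W_def V_def)
    also have "\<dots> = measure_pmf.prob (L y) A + card A * \<delta>"
      using \<open>finite A\<close> by (simp add: sum.distrib measure_measure_pmf_finite)
    also have "card A \<le> card I"
      using A L[OF x] fin by (intro card_mono) auto
    then have "card A * \<delta> \<le> card I * \<delta>"
      using \<delta>(1) by (intro mult_right_mono) auto
    finally show "measure_pmf.prob (L x) A \<le> measure_pmf.prob (L y) {j. \<exists>i\<in>A. i = j} + e"
      using \<delta>(2) by simp
  qed
  ultimately show "\<exists>U. openin T U \<and> x \<in> U \<and> (\<forall>y\<in>U.
      mdist (Bn n Z) (map_pmf (\<lambda>i. a i x) (L x)) (map_pmf (\<lambda>i. a i y) (L y)) \<le> e)"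
    by (intro exI[of _ W]) simp
qed

lemma dcat_le_LS_cat:
  assumes conn: "path_connected_space (mtopology_of X)" and x0: "x0 \<in> mspace X"
  shows "dcat X x0 \<le> LS_cat (mtopology_of X)"
proof -
  let ?T = "mtopology_of X"
  have covering: "\<exists>H. continuous_map ?T (mtopology_of (Bn (n + 1) (paths_to X x0))) H \<and>
      (\<forall>x\<in>mspace X. H x \<in> mspace (Bn (n + 1) (paths_between X x x0)))"
    if U: "\<forall>i\<le>n. openin ?T (U i) \<and> contractible_in ?T (U i)" and cover: "topspace ?T = (\<Union>i\<le>n. U i)"
    for n and U :: "nat \<Rightarrow> 'a set"
  proof -
    have "\<exists>h. continuous_map (prod_topology unit_interval (subtopology ?T (U i))) ?T h \<and>
        (\<forall>x. h (0, x) = x \<and> h (1, x) = x0)" if i: "i \<le> n" for i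
    proof -
      obtain c where c: "c \<in> mspace X" "homotopic_with (\<lambda>_. True) (subtopology ?T (U i)) ?T id (\<lambda>_. c)"
        using U i unfolding contractible_in_def by auto
      have "path_component_of ?T c x0"
        using conn c(1) x0 by (simp add: path_connected_space_iff_path_component)
      then have "homotopic_with (\<lambda>_. True) (subtopology ?T (U i)) ?T (\<lambda>_. c) (\<lambda>_. x0)"
        by (simp add: homotopic_constant_maps)
      from homotopic_with_trans[OF c(2) this] show ?thesis
        unfolding homotopic_with_def by auto
    qed
    then obtain h where h: "\<And>i. i \<le> n \<Longrightarrow>
        continuous_map (prod_topology unit_interval (subtopology ?T (U i))) ?T (h i) \<and>
        (\<forall>x. h i (0, x) = x \<and> h i (1, x) = x0)"
      by metis
    define a where "a i x = (\<lambda>t\<in>{0..1}. h i (t, x))" for i x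
    have a_path: "continuous_map (subtopology ?T (U i)) (mtopology_of (path_metric X)) (a i)" if "i \<le> n" for i
      unfolding a_def using h[OF that] by (intro continuous_map_curry_path) simp
    have ends: "a i x 0 = x" "a i x 1 = x0" if "i \<le> n" for i x
      using h[OF that] by (simp_all add: a_def)
    have a: "continuous_map (subtopology ?T (U i)) (mtopology_of (paths_to X x0)) (a i)" if "i \<le> n" for i
      unfolding paths_to_def mtopology_of_submetric continuous_map_in_subtopology
      using a_path ends that by auto
    have "\<exists>\<phi>. continuous_map ?T euclideanreal \<phi> \<and> (\<forall>x. 0 \<le> \<phi> x) \<and> (\<forall>x\<in>mspace X. 0 < \<phi> x \<longleftrightarrow> x \<in> U i)"
      if "i \<le> n" for i
      using openin_metric_cozero_set[of X "U i"] U that by metis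
    then obtain \<phi> where \<phi>: "\<And>i. i \<le> n \<Longrightarrow> continuous_map ?T euclideanreal (\<phi> i)"
        "\<And>i x. i \<le> n \<Longrightarrow> 0 \<le> \<phi> i x" "\<And>i x. i \<le> n \<Longrightarrow> x \<in> mspace X \<Longrightarrow> 0 < \<phi> i x \<longleftrightarrow> x \<in> U i"
      by metis
    define s where "s x = (\<Sum>i\<le>n. \<phi> i x)" for x
    have s: "0 < s x" if x: "x \<in> mspace X" for x
    proof -
      obtain i where "i \<le> n" "x \<in> U i"
        using cover x by auto
      then show ?thesis
        unfolding s_def using \<phi>(2,3) x by (intro sum_pos2[of _ i]) auto
    qed
    have "\<exists>p. set_pmf p = {i \<in> {..n}. 0 < \<phi> i x / s x} \<and> (\<forall>i\<in>{..n}. pmf p i = \<phi> i x / s x)"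
      if x: "x \<in> mspace X" for x
    proof -
      have "(\<Sum>i\<le>n. \<phi> i x / s x) = 1"
        using s[OF x] by (simp add: s_def flip: sum_divide_distrib)
      then show ?thesis
        using finite_pmf_exists[of "{..n}" "\<lambda>i. \<phi> i x / s x"] \<phi>(2) s[OF x] by (metis atMost_iff divide_nonneg_pos finite_atMost)
    qed
    then obtain L where L: "\<And>x. x \<in> mspace X \<Longrightarrow> set_pmf (L x) = {i \<in> {..n}. 0 < \<phi> i x / s x} \<and>
        (\<forall>i\<in>{..n}. pmf (L x) i = \<phi> i x / s x)"
      by metis
    have supp: "set_pmf (L x) \<subseteq> {i \<in> {..n}. x \<in> U i}" if x: "x \<in> mspace X" for x
      using L[OF x] \<phi>(3)[OF _ x] s[OF x] by (auto simp: zero_less_divide_iff)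
    define H where "H x = map_pmf (\<lambda>i. a i x) (L x)" for x
    have "continuous_map ?T (mtopology_of (Bn (n + 1) (paths_to X x0))) H"
      unfolding H_def
    proof (rule continuous_map_finite_mixture[where I = "{..n}" and U = U])
      fix i assume i: "i \<in> {..n}"
      have "continuous_map ?T euclideanreal (\<lambda>x. \<phi> i x / s x)"
        using i \<phi>(1) s unfolding s_def
        by (intro continuous_map_real_divide continuous_map_sum) (auto simp: less_le)
      then show "continuous_map ?T euclideanreal (\<lambda>x. pmf (L x) i)"
        by (rule continuous_map_eq) (use L i in auto)
    qed (use U a supp in auto)
    moreover have "H x \<in> mspace (Bn (n + 1) (paths_between X x x0))" if x: "x \<in> mspace X" for x
    proof -
      have "H x \<in> mspace (Bn (n + 1) (paths_to X x0))"
        using continuous_map_in_mspace[OF calculation] x by simp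
      moreover have "\<alpha> 0 = x" if "\<alpha> \<in> set_pmf (H x)" for \<alpha>
        using that supp[OF x] ends by (auto simp: H_def)
      ultimately show ?thesis
        by (auto simp: finsupp_measures_def paths_to_def paths_between_def)
    qed
    ultimately show ?thesis
      by blast
  qed
  show ?thesis
    unfolding dcat_def LS_cat_def
    by (intro Inf_superset_mono Collect_mono impI)
      (elim exE conjE, rule exI, rule conjI, assumption, rule covering, assumption+)
qed

lemma homotopy_domination_of_retraction:
  assumes "continuous_map W X r" "continuous_map X W i" "\<And>x. x \<in> topspace X \<Longrightarrow> r (i x) = x"
  shows "homotopy_domination W X r"
  unfolding homotopy_domination_def using assms
  by (intro conjI exI[of _ i] homotopic_with_equal continuous_map_compose[of X W]) auto

theorem proposition4p11:
  fixes X :: "'a metric" and Y :: "'b metric"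
  assumes "path_connected_space (mtopology_of X)" and "ANR_space (mtopology_of X)"
    and "path_connected_space (mtopology_of Y)" and "ANR_space (mtopology_of Y)"
    and "x0 \<in> mspace X" and "y0 \<in> mspace Y"
  shows "(icat X x0 \<le> dcat X x0 \<and> dcat X x0 \<le> LS_cat (mtopology_of X)) \<and>
    (\<forall>f. homotopy_domination (mtopology_of X) (mtopology_of Y) f \<longrightarrow> icat Y y0 \<le> icat X x0) \<and>
    (mtopology_of X homotopy_equivalent_space mtopology_of Y \<longrightarrow> icat X x0 = icat Y y0) \<and>
    (\<forall>a \<in> mspace X. \<forall>b \<in> mspace Y.
       \<forall>w0 \<in> mspace (wedge_metric X a Y b). \<forall>p0 \<in> mspace (prod_metric X Y).
         max (icat X x0) (icat Y y0) \<le>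
         min (icat (wedge_metric X a Y b) w0) (icat (prod_metric X Y) p0))"
proof (intro conjI allI impI ballI)
  note X = assms(1) and Y = assms(3) and x0 = assms(5) and y0 = assms(6)
  show "icat X x0 \<le> dcat X x0"
    by (rule icat_le_dcat)
  show "dcat X x0 \<le> LS_cat (mtopology_of X)"
    using X x0 by (rule dcat_le_LS_cat)
  show "icat Y y0 \<le> icat X x0" if "homotopy_domination (mtopology_of X) (mtopology_of Y) f" for f
    using that Y x0 y0 by (rule icat_le_of_homotopy_domination)
  show "icat X x0 = icat Y y0" if equiv: "mtopology_of X homotopy_equivalent_space mtopology_of Y"
  proof -
    obtain f g where "continuous_map (mtopology_of X) (mtopology_of Y) f"
        "continuous_map (mtopology_of Y) (mtopology_of X) g"
        "homotopic_with (\<lambda>_. True) (mtopology_of X) (mtopology_of X) (g \<circ> f) id"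
        "homotopic_with (\<lambda>_. True) (mtopology_of Y) (mtopology_of Y) (f \<circ> g) id"
      using equiv unfolding homotopy_equivalent_space_def by blast
    then have "homotopy_domination (mtopology_of X) (mtopology_of Y) f"
        "homotopy_domination (mtopology_of Y) (mtopology_of X) g"
      unfolding homotopy_domination_def by blast+
    then show ?thesis
      using X Y x0 y0 by (intro antisym icat_le_of_homotopy_domination)
  qed
  fix a b w0 p0
  assume a: "a \<in> mspace X" and b: "b \<in> mspace Y"
    and w0: "w0 \<in> mspace (wedge_metric X a Y b)" and p0: "p0 \<in> mspace (prod_metric X Y)"
  let ?P = "prod_topology (mtopology_of X) (mtopology_of Y)"
  have wedge: "mtopology_of (wedge_metric X a Y b) = subtopology ?P (mspace X \<times> {b} \<union> {a} \<times> mspace Y)"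
    by (simp add: wedge_metric_def mtopology_of_submetric)
  have in1: "continuous_map (mtopology_of X) ?P (\<lambda>x. (x, b))"
    and in2: "continuous_map (mtopology_of Y) ?P (\<lambda>y. (a, y))"
    using a b by (auto intro!: continuous_map_pairedI)
  have "homotopy_domination ?P (mtopology_of X) fst" "homotopy_domination ?P (mtopology_of Y) snd"
    by (auto intro: homotopy_domination_of_retraction[OF _ in1] homotopy_domination_of_retraction[OF _ in2]
        continuous_map_fst continuous_map_snd)
  then have P: "icat X x0 \<le> icat (prod_metric X Y) p0" "icat Y y0 \<le> icat (prod_metric X Y) p0"
    using icat_le_of_homotopy_domination[of "prod_metric X Y" X fst p0 x0]
      icat_le_of_homotopy_domination[of "prod_metric X Y" Y snd p0 y0] X Y x0 y0 p0 by simp_all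
  have "homotopy_domination (mtopology_of (wedge_metric X a Y b)) (mtopology_of X) fst"
    unfolding wedge using in1 a b
    by (intro homotopy_domination_of_retraction[where i = "\<lambda>x. (x, b)"])
      (auto simp: continuous_map_in_subtopology intro: continuous_map_from_subtopology continuous_map_fst)
  moreover have "homotopy_domination (mtopology_of (wedge_metric X a Y b)) (mtopology_of Y) snd"
    unfolding wedge using in2 a b
    by (intro homotopy_domination_of_retraction[where i = "\<lambda>y. (a, y)"])
      (auto simp: continuous_map_in_subtopology intro: continuous_map_from_subtopology continuous_map_snd)
  ultimately have W: "icat X x0 \<le> icat (wedge_metric X a Y b) w0" "icat Y y0 \<le> icat (wedge_metric X a Y b) w0"
    using icat_le_of_homotopy_domination[OF _ X w0 x0] icat_le_of_homotopy_domination[OF _ Y w0 y0] by blast+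
  show "max (icat X x0) (icat Y y0) \<le> min (icat (wedge_metric X a Y b) w0) (icat (prod_metric X Y) p0)"
    using P W by simp
qed

end
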